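(* Let $(\mathfrak g,J,g)$ be a four dimensional Kähler Lie algebra with Einstein metric $g$. If $g$ is not Ricci flat, then, up to a Lie algebra isomorphism carrying the complex structure and the metric, $(\mathfrak g,J,g)$ is one of the following, with some $\alpha\in\mathbb R$, $\alpha\ne0$: - $\mathfrak{aff}(\mathbb R)\times\mathfrak{aff}(\mathbb R)$ with $J$, $g=\alpha(e^1\cdot e^1+e^2\cdot e^2+e^3\cdot e^3+e^4\cdot e^4)$; - $\mathfrak{aff}(\mathbb C)$ with $J_1$, $g=\alpha(e^1\cdot e^1-e^2\cdot e^2+e^3\cdot e^3-e^4\cdot e^4)$; - $\mathfrak d_{4,1/2}$ with $J_1$, $g=\alpha(e^1\cdot e^1+e^2\cdot e^2+e^3\cdot e^3+e^4\cdot e^4)$; - $\mathfrak d_{4,1/2}$ with $J_2$, $g=\alpha(e^1\cdot e^1+e^2\cdot e^2-e^3\cdot e^3-e^4\cdot e^4)$; - $\mathfrak d'_{4,\delta}$, $\delta>0$, with $J_1$ or $J_3$, $g=\alpha\big(e^1\cdot e^1+e^2\cdot e^2+\delta(e^3\cdot e^3+e^4\cdot e^4)\big)$; - $\mathfrak d'_{4,\delta}$, $\delta>0$, with $J_2$ or $J_4$, $g=\alpha\big(e^1\cdot e^1+e^2\cdot e^2-\delta(e^3\cdot e^3+e^4\cdot e^4)\big)$.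
   Context: All Lie algebras are real. A complex structure is an endomorphism $J$ with $J^2=-I$ and $[Jx,Jy]-[x,y]-J[Jx,y]-J[x,Jy]=0$. A Kähler Lie algebra is a Lie algebra with a complex structure $J$ and a closed nondegenerate 2-form $\omega$ (closed: $\omega([x,y],z)+\omega([y,z],x)+\omega([z,x],y)=0$) with $\omega(Jx,Jy)=\omega(x,y)$; the associated pseudo-Kähler metric is $g(x,y)=\omega(Jx,y)$, not necessarily definite, and one writes $(\mathfrak g,J,g)$. The Levi-Civita connection is given by $2g(\nabla_xy,z)=g([x,y],z)-g([y,z],x)+g([z,x],y)$, the curvature by $R(x,y)=[\nabla_x,\nabla_y]-\nabla_{[x,y]}$, the Ricci tensor by $ric(x,y)=-\sum_i\varepsilon_i\,g(R(x,v_i)y,v_i)$ for an orthonormal basis $\{v_i\}$, $\varepsilon_i=g(v_i,v_i)=\pm1$. $g$ is Einstein if $ric=\nu g$ for a real constant $\nu$, and Ricci flat if $ric\equiv 0$. $\{e^i\}$ is the basis dual to $\{e_i\}$ and $\cdot$ is the symmetric product of 1-forms, with $e^i\cdot e^i=e^i\otimes e^i$. In a basis $e_1,\dots,e_4$: $\mathfrak{aff}(\mathbb R)\times\mathfrak{aff}(\mathbb R)$: $[e_1,e_2]=e_2$, $[e_3,e_4]=e_4$; $Je_1=e_2$, $Je_3=e_4$. $\mathfrak{aff}(\mathbb C)$: $[e_1,e_3]=e_3$, $[e_1,e_4]=e_4$, $[e_2,e_3]=e_4$, $[e_2,e_4]=-e_3$; $J_1e_1=e_3$, $J_1e_2=e_4$.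 $\mathfrak d_{4,1/2}$: $[e_1,e_2]=e_3$, $[e_4,e_3]=e_3$, $[e_4,e_1]=\frac12e_1$, $[e_4,e_2]=\frac12e_2$; $J_1e_4=e_3$, $J_1e_1=e_2$; $J_2e_4=e_3$, $J_2e_1=-e_2$. $\mathfrak d'_{4,\delta}$: $[e_1,e_2]=e_3$, $[e_4,e_1]=\frac\delta2e_1-e_2$, $[e_4,e_3]=\delta e_3$, $[e_4,e_2]=e_1+\frac\delta2e_2$; $J_1e_1=e_2$, $J_1e_4=e_3$; $J_2e_1=e_2$, $J_2e_4=-e_3$; $J_3e_1=-e_2$, $J_3e_4=-e_3$; $J_4e_1=-e_2$, $J_4e_4=e_3$. *)

theory Defs
  imports "HOL-Analysis.Analysis"
begin

section \<open>Kaehler Lie algebras\<close>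

locale lie_algebra =
  fixes br :: "'a::real_vector \<Rightarrow> 'a \<Rightarrow> 'a"
  assumes bilinear_br: "bilinear br"
    and alternating_br: "br x x = 0"
    and jacobi: "br (br x y) z + br (br y z) x + br (br z x) y = 0"

locale complex_lie_algebra = lie_algebra br
  for br :: "'a::real_vector \<Rightarrow> 'a \<Rightarrow> 'a" +
  fixes J :: "'a \<Rightarrow> 'a"
  assumes linear_J: "linear J"
    and J_J: "J (J x) = - x"
    and integrable_J: "br (J x) (J y) - br x y - J (br (J x) y) - J (br x (J y)) = 0"

locale kaehler_lie_algebra = complex_lie_algebra br J
  for br :: "'a::real_vector \<Rightarrow> 'a \<Rightarrow> 'a" and J :: "'a \<Rightarrow> 'a" +
  fixes \<omega> :: "'a \<Rightarrow> 'a \<Rightarrow> real"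
  assumes bilinear_\<omega>: "bilinear \<omega>"
    and alternating_\<omega>: "\<omega> x x = 0"
    and nondegenerate_\<omega>: "(\<And>y. \<omega> x y = 0) \<Longrightarrow> x = 0"
    and closed_\<omega>: "\<omega> (br x y) z + \<omega> (br y z) x + \<omega> (br z x) y = 0"
    and J_invariant_\<omega>: "\<omega> (J x) (J y) = \<omega> x y"

definition kaehler_metric :: "('a \<Rightarrow> 'a) \<Rightarrow> ('a \<Rightarrow> 'a \<Rightarrow> real) \<Rightarrow> 'a \<Rightarrow> 'a \<Rightarrow> real" where
  "kaehler_metric J \<omega> x y = \<omega> (J x) y"


section \<open>Curvature of a left-invariant pseudo-Riemannian metric\<close>

text \<open>For a nondegenerate metric on a finite-dimensional space the Koszul formula determines the
  vector \<open>w\<close> uniquely.\<close>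

definition levi_civita ::
  "('a::real_vector \<Rightarrow> 'a \<Rightarrow> 'a) \<Rightarrow> ('a \<Rightarrow> 'a \<Rightarrow> real) \<Rightarrow> 'a \<Rightarrow> 'a \<Rightarrow> 'a" where
  "levi_civita br g x y =
     (THE w. \<forall>z. 2 * g w z = g (br x y) z - g (br y z) x + g (br z x) y)"

definition curvature ::
  "('a::real_vector \<Rightarrow> 'a \<Rightarrow> 'a) \<Rightarrow> ('a \<Rightarrow> 'a \<Rightarrow> real) \<Rightarrow> 'a \<Rightarrow> 'a \<Rightarrow> 'a \<Rightarrow> 'a" where
  "curvature br g x y z =
     levi_civita br g x (levi_civita br g y z) - levi_civita br g y (levi_civita br g x z)
       - levi_civita br g (br x y) z"

definition orthonormal_basis :: "('a::real_vector \<Rightarrow> 'a \<Rightarrow> real) \<Rightarrow> 'a set \<Rightarrow> bool" where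
  "orthonormal_basis g B \<longleftrightarrow>
     independent B \<and> span B = UNIV \<and>
     (\<forall>u\<in>B. \<forall>v\<in>B. u \<noteq> v \<longrightarrow> g u v = 0) \<and>
     (\<forall>v\<in>B. g v v = 1 \<or> g v v = - 1)"

text \<open>The sum does not depend on the orthonormal basis, so an arbitrary one is chosen.\<close>

definition ricci ::
  "('a::real_vector \<Rightarrow> 'a \<Rightarrow> 'a) \<Rightarrow> ('a \<Rightarrow> 'a \<Rightarrow> real) \<Rightarrow> 'a \<Rightarrow> 'a \<Rightarrow> real" where
  "ricci br g x y =
     - (\<Sum>v\<in>(SOME B. orthonormal_basis g B). g v v * g (curvature br g x v y) v)"

definition einstein :: "('a::real_vector \<Rightarrow> 'a \<Rightarrow> 'a) \<Rightarrow> ('a \<Rightarrow> 'a \<Rightarrow> real) \<Rightarrow> bool" where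
  "einstein br g \<longleftrightarrow> (\<exists>\<nu>. \<forall>x y. ricci br g x y = \<nu> * g x y)"

definition ricci_flat :: "('a::real_vector \<Rightarrow> 'a \<Rightarrow> 'a) \<Rightarrow> ('a \<Rightarrow> 'a \<Rightarrow> real) \<Rightarrow> bool" where
  "ricci_flat br g \<longleftrightarrow> (\<forall>x y. ricci br g x y = 0)"


section \<open>Equivalence\<close>

definition equivalent_to ::
  "('a::real_vector \<Rightarrow> 'a \<Rightarrow> 'a) \<Rightarrow> ('a \<Rightarrow> 'a) \<Rightarrow> ('a \<Rightarrow> 'a \<Rightarrow> real) \<Rightarrow>
   ('b::real_vector \<Rightarrow> 'b \<Rightarrow> 'b) \<Rightarrow> ('b \<Rightarrow> 'b) \<Rightarrow> ('b \<Rightarrow> 'b \<Rightarrow> real) \<Rightarrow> bool" where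
  "equivalent_to br J g br' J' g' \<longleftrightarrow>
     (\<exists>\<phi>. linear \<phi> \<and> bij \<phi> \<and>
        (\<forall>x y. \<phi> (br x y) = br' (\<phi> x) (\<phi> y)) \<and>
        (\<forall>x. \<phi> (J x) = J' (\<phi> x)) \<and>
        (\<forall>x y. g x y = g' (\<phi> x) (\<phi> y)))"


section \<open>The model Lie algebras\<close>

abbreviation e :: "4 \<Rightarrow> real^4" where
  "e i \<equiv> axis i 1"

text \<open>The 2-form \<open>wedge i j\<close> sends \<open>(e i, e j)\<close> to \<open>1\<close>, so that a term \<open>wedge i j x y *\<^sub>R v\<close> in a
  bracket stands for the table entry \<open>[e i, e j] = v\<close>.\<close>

definition wedge :: "4 \<Rightarrow> 4 \<Rightarrow> real^4 \<Rightarrow> real^4 \<Rightarrow> real" where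
  "wedge i j x y = x $ i * y $ j - x $ j * y $ i"

text \<open>A summand \<open>rot i j\<close> in a complex structure stands for \<open>J (e i) = e j\<close>, and hence also
  \<open>J (e j) = - e i\<close>; likewise \<open>- rot i j\<close> stands for \<open>J (e i) = - e j\<close> and \<open>J (e j) = e i\<close>.\<close>

definition rot :: "4 \<Rightarrow> 4 \<Rightarrow> real^4 \<Rightarrow> real^4" where
  "rot i j x = x $ i *\<^sub>R e j - x $ j *\<^sub>R e i"

text \<open>The symmetric square of the dual basis vector: \<open>e\<^sup>i \<cdot> e\<^sup>i = e\<^sup>i \<otimes> e\<^sup>i\<close>.\<close>

definition sq :: "4 \<Rightarrow> real^4 \<Rightarrow> real^4 \<Rightarrow> real" where
  "sq i x y = x $ i * y $ i"

definition affR_affR :: "real^4 \<Rightarrow> real^4 \<Rightarrow> real^4" where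
  "affR_affR x y = wedge 1 2 x y *\<^sub>R e 2 + wedge 3 4 x y *\<^sub>R e 4"

definition affR_affR_J :: "real^4 \<Rightarrow> real^4" where
  "affR_affR_J x = rot 1 2 x + rot 3 4 x"

definition affC :: "real^4 \<Rightarrow> real^4 \<Rightarrow> real^4" where
  "affC x y =
     wedge 1 3 x y *\<^sub>R e 3 + wedge 1 4 x y *\<^sub>R e 4 + wedge 2 3 x y *\<^sub>R e 4 + wedge 2 4 x y *\<^sub>R (- e 3)"

definition affC_J1 :: "real^4 \<Rightarrow> real^4" where
  "affC_J1 x = rot 1 3 x + rot 2 4 x"

definition d4_half :: "real^4 \<Rightarrow> real^4 \<Rightarrow> real^4" where
  "d4_half x y =
     wedge 1 2 x y *\<^sub>R e 3 + wedge 4 3 x y *\<^sub>R e 3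
       + wedge 4 1 x y *\<^sub>R ((1/2) *\<^sub>R e 1) + wedge 4 2 x y *\<^sub>R ((1/2) *\<^sub>R e 2)"

definition d4_half_J1 :: "real^4 \<Rightarrow> real^4" where
  "d4_half_J1 x = rot 4 3 x + rot 1 2 x"

definition d4_half_J2 :: "real^4 \<Rightarrow> real^4" where
  "d4_half_J2 x = rot 4 3 x - rot 1 2 x"

definition d4' :: "real \<Rightarrow> real^4 \<Rightarrow> real^4 \<Rightarrow> real^4" where
  "d4' \<delta> x y =
     wedge 1 2 x y *\<^sub>R e 3 + wedge 4 1 x y *\<^sub>R ((\<delta>/2) *\<^sub>R e 1 - e 2)
       + wedge 4 3 x y *\<^sub>R (\<delta> *\<^sub>R e 3) + wedge 4 2 x y *\<^sub>R (e 1 + (\<delta>/2) *\<^sub>R e 2)"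

definition d4'_J1 :: "real^4 \<Rightarrow> real^4" where
  "d4'_J1 x = rot 1 2 x + rot 4 3 x"

definition d4'_J2 :: "real^4 \<Rightarrow> real^4" where
  "d4'_J2 x = rot 1 2 x - rot 4 3 x"

definition d4'_J3 :: "real^4 \<Rightarrow> real^4" where
  "d4'_J3 x = - rot 1 2 x - rot 4 3 x"

definition d4'_J4 :: "real^4 \<Rightarrow> real^4" where
  "d4'_J4 x = - rot 1 2 x + rot 4 3 x"

end

theory Submission
  imports Defs
begin

text \<open>
  Two ideas carry the proof.

  First, the Ricci form of a Kaehler Lie algebra is the differential of a linear form, the Koszul
  form \<open>\<psi>(x) = tr (J ad x - ad (J x))\<close>: one has \<open>ric(x, J y) - ric(y, J x) = \<psi>([x, y])\<close>
  (\<open>ricci_koszul_form\<close>). If the metric is Einstein with constant \<open>\<nu> \<noteq> 0\<close>, the left hand side is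
  \<open>2 \<nu> \<omega>(x, y)\<close>, so \<open>\<omega>\<close> is recovered from the Lie algebra and \<open>J\<close> alone up to a constant, and
  the form \<open>\<psi>([x, y])\<close> is nondegenerate (\<open>einstein_exact\<close>). What remains is to find all pairs
  \<open>(\<g>, J)\<close> of real dimension four with this nondegeneracy.

  Second, such pairs are described by few complex numbers. The complexification is a direct sum of
  the subalgebra \<open>\<q> = {x + \<i> J x}\<close> and its conjugate, so its bracket consists of the bracket of
  \<open>\<q>\<close> and of the action of \<open>\<q>\<close> on the complement \<open>\<g>\<^sub>\<complex> / \<q>\<close>. Transported to \<open>\<g>\<close>, viewed as a
  complex vector space of dimension two by means of \<open>J\<close>, these are a complex bilinear alternating
  product \<open>x \<star> y\<close> and operators \<open>D x\<close>, complex linear and antilinear in \<open>x\<close>, with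
  \<open>2 [x, y] = x \<star> y + D x y - D y x\<close>. The Jacobi identity says that \<open>D\<close> represents \<open>\<star>\<close>
  (\<open>D_star\<close>), together with a compatibility (\<open>D_on_star\<close>), and \<open>\<psi>(x)\<close> is
  \<open>- 2 Im tr (D x)\<close> for the complex trace.

  If \<open>\<star>\<close> vanishes, the operators commute and have a common eigenvector. Nondegeneracy leaves two
  multiplication tables, those of \<open>\<real> \<oplus> \<real>\<close> and of \<open>\<complex>\<close> after extension of scalars
  (\<open>abelian_normal_form\<close>); they give \<open>\<aa>\<ff>\<ff>(\<real>) \<times> \<aa>\<ff>\<ff>(\<real>)\<close> and \<open>\<aa>\<ff>\<ff>(\<complex>)\<close>. Otherwise \<open>a \<star> b = b\<close>
  for some basis, \<open>D b\<close> is nilpotent and by nondegeneracy not zero, and what is left is a sign, which is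
  the sign of \<open>\<rho>\<close>, and a point of the unit circle, encoded in \<open>\<tau>\<close> (\<open>nonabelian_normal_form\<close>);
  \<open>\<tau> = 0\<close> gives \<open>\<dd>\<^sub>4\<close> with parameter one half, and \<open>\<tau> \<noteq> 0\<close> gives \<open>\<dd>'\<^sub>4\<close> with
  \<open>\<delta> = 1 / \<bar>\<tau>\<bar>\<close>, where the signs of \<open>\<rho>\<close> and \<open>\<tau>\<close> distinguish the four complex structures
  (\<open>heisenberg_model\<close>).
\<close>

section \<open>Orthonormal bases and traces\<close>

locale nondegenerate_form =
  fixes g :: "'a::real_vector \<Rightarrow> 'a \<Rightarrow> real"
  assumes bilinear_g: "bilinear g"
    and sym_g: "g x y = g y x"
    and nondegenerate_g: "(\<And>y. g x y = 0) \<Longrightarrow> x = 0"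
    and finite_dim: "\<exists>S::'a set. finite S \<and> span S = UNIV"
begin

lemmas g_simps = bilinear_ladd[OF bilinear_g] bilinear_radd[OF bilinear_g]
  bilinear_lmul[OF bilinear_g] bilinear_rmul[OF bilinear_g]
  bilinear_lsub[OF bilinear_g] bilinear_rsub[OF bilinear_g]
  bilinear_lneg[OF bilinear_g] bilinear_rneg[OF bilinear_g]
  bilinear_lzero[OF bilinear_g] bilinear_rzero[OF bilinear_g]

lemma linear_g_left: "linear (\<lambda>x. g x y)"
  using bilinear_g by (simp add: bilinear_def)

lemma linear_g_right: "linear (g x)"
  using bilinear_g by (simp add: bilinear_def)

lemma g_eqI: "(\<And>z. g x z = g y z) \<Longrightarrow> x = y"
  using nondegenerate_g[of "x - y"] by (simp add: g_simps)

definition orthonormal :: "'a set \<Rightarrow> bool" where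
  "orthonormal B \<longleftrightarrow> finite B \<and> (\<forall>u\<in>B. \<forall>v\<in>B. u \<noteq> v \<longrightarrow> g u v = 0) \<and>
     (\<forall>v\<in>B. g v v = 1 \<or> g v v = - 1)"

lemma g_sum_orthonormal:
  assumes "orthonormal B" "u \<in> B"
  shows "g (\<Sum>v\<in>B. c v *\<^sub>R v) u = c u * g u u"
proof -
  have "g (\<Sum>v\<in>B. c v *\<^sub>R v) u = (\<Sum>v\<in>B. c v * g v u)"
    by (simp add: linear_sum[OF linear_g_left] g_simps)
  also have "\<dots> = (\<Sum>v\<in>B. if v = u then c u * g u u else 0)"
    by (rule sum.cong) (use assms in \<open>auto simp: orthonormal_def\<close>)
  also have "\<dots> = c u * g u u"
    using assms by (simp add: orthonormal_def)
  finally show ?thesis .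
qed

lemma orthonormal_independent:
  assumes "orthonormal B" shows "independent B"
proof
  assume "dependent B"
  moreover have "finite B" using assms by (simp add: orthonormal_def)
  ultimately obtain c v where c: "v \<in> B" "c v \<noteq> 0" "(\<Sum>v\<in>B. c v *\<^sub>R v) = 0"
    by (auto simp: dependent_finite)
  then have "c v * g v v = 0"
    using g_sum_orthonormal[OF assms c(1), of c] by (simp add: g_simps)
  with c assms show False by (auto simp: orthonormal_def)
qed

text \<open>An orthonormal set of maximal cardinality spans: on its orthogonal complement every vector is
  isotropic (a non-isotropic one could be normalised and added), so by polarisation the form vanishes
  there, and by nondegeneracy the complement is zero.\<close>

lemma ex_orthonormal_basis: "\<exists>B. orthonormal_basis g B"
proof -
  obtain S :: "'a set" where S: "finite S" "span S = UNIV" using finite_dim by blast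
  have "card B \<le> card S" if "orthonormal B" for B
    using independent_span_bound[OF S(1) orthonormal_independent[OF that]] S by simp
  then have "\<forall>B. orthonormal B \<longrightarrow> card B < Suc (card S)" by (simp add: le_imp_less_Suc)
  moreover have "orthonormal {}" by (simp add: orthonormal_def)
  ultimately have "\<exists>B. orthonormal B \<and> (\<forall>B'. orthonormal B' \<longrightarrow> card B' \<le> card B)"
    by (intro ex_has_greatest_nat)
  then obtain B where B: "orthonormal B" and max: "\<And>B'. orthonormal B' \<Longrightarrow> card B' \<le> card B"
    by blast
  have finB: "finite B" and unit: "\<And>v. v \<in> B \<Longrightarrow> g v v * g v v = 1"
    using B by (auto simp: orthonormal_def)
  have isotropic: "g w w = 0" if w: "\<And>v. v \<in> B \<Longrightarrow> g w v = 0" for w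
  proof (rule ccontr)
    assume nz: "g w w \<noteq> 0"
    define n where "n = (1 / sqrt \<bar>g w w\<bar>) *\<^sub>R w"
    have "g n n = g w w / \<bar>g w w\<bar>"
      by (simp add: n_def g_simps)
    then have n1: "g n n = 1 \<or> g n n = - 1" using nz by (auto simp: abs_if)
    have n0: "g n v = 0" "g v n = 0" if "v \<in> B" for v
      using w[OF that] sym_g[of w v] by (auto simp: n_def g_simps)
    have "n \<notin> B" using n0 n1 by force
    moreover have "orthonormal (insert n B)"
      using B n0 n1 by (auto simp: orthonormal_def)
    ultimately show False using max[of "insert n B"] finB by simp
  qed
  have "x \<in> span B" for x
  proof -
    define w where "w = x - (\<Sum>v\<in>B. (g v v * g x v) *\<^sub>R v)"
    have perp: "g (y - (\<Sum>v\<in>B. (g v v * g y v) *\<^sub>R v)) u = 0" if "u \<in> B" for u y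
      using unit[OF that] by (simp add: g_simps g_sum_orthonormal[OF B that])
    have wu: "g w u = 0" if "u \<in> B" for u
      using perp[OF that] by (simp add: w_def)
    have "g w y = 0" for y
    proof -
      define y' where "y' = y - (\<Sum>v\<in>B. (g v v * g y v) *\<^sub>R v)"
      have y': "g y' u = 0" if "u \<in> B" for u using perp[OF that] by (simp add: y'_def)
      have "g (w + y') (w + y') = 0" by (rule isotropic) (simp add: g_simps wu y')
      then have "g w y' = 0"
        using isotropic[of w] isotropic[of y'] wu y' sym_g[of w y'] by (simp add: g_simps)
      moreover have "g w (\<Sum>v\<in>B. (g v v * g y v) *\<^sub>R v) = 0"
        by (simp add: linear_sum[OF linear_g_right] g_simps wu)
      ultimately show ?thesis by (simp add: y'_def g_simps)
    qed
    then have "w = 0" by (rule nondegenerate_g)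
    then have "x = (\<Sum>v\<in>B. (g v v * g x v) *\<^sub>R v)" by (simp add: w_def)
    also have "\<dots> \<in> span B" by (intro span_sum span_scale span_base)
    finally show ?thesis .
  qed
  then show ?thesis
    using B orthonormal_independent[OF B] unfolding orthonormal_basis_def orthonormal_def by blast
qed

definition onb :: "'a set" where
  "onb = (SOME B. orthonormal_basis g B)"

lemma onb: "orthonormal_basis g onb"
  unfolding onb_def using ex_orthonormal_basis by (rule someI_ex)

lemma orthonormal_onb: "orthonormal onb"
proof -
  have "finite onb"
    using onb finite_dim independent_span_bound[of _ onb] by (force simp: orthonormal_basis_def)
  then show ?thesis using onb by (auto simp: orthonormal_basis_def orthonormal_def)
qed

lemma onb_unit: "v \<in> onb \<Longrightarrow> g v v * g v v = 1"
  using orthonormal_onb by (auto simp: orthonormal_def)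

lemma onb_expansion: "(\<Sum>v\<in>onb. (g v v * g x v) *\<^sub>R v) = x"
proof -
  obtain c where c: "x = (\<Sum>v\<in>onb. c v *\<^sub>R v)"
  proof -
    have "x \<in> range (\<lambda>c. \<Sum>v\<in>onb. c v *\<^sub>R v)"
      using onb orthonormal_onb span_finite[of onb] by (simp add: orthonormal_basis_def orthonormal_def)
    then show ?thesis using that by blast
  qed
  have "(g v v * g x v) = c v" if "v \<in> onb" for v
    using onb_unit[OF that] g_sum_orthonormal[OF orthonormal_onb that, of c] c by (simp add: ac_simps)
  then have "(\<Sum>v\<in>onb. (g v v * g x v) *\<^sub>R v) = (\<Sum>v\<in>onb. c v *\<^sub>R v)" by simp
  with c show ?thesis by simp
qed

definition trace :: "('a \<Rightarrow> 'a) \<Rightarrow> real" where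
  "trace T = (\<Sum>v\<in>onb. g v v * g (T v) v)"

lemma trace_add: "trace (\<lambda>v. S v + T v) = trace S + trace T"
  by (simp add: trace_def g_simps sum.distrib algebra_simps)

lemma trace_diff: "trace (\<lambda>v. S v - T v) = trace S - trace T"
  by (simp add: trace_def g_simps sum_subtractf algebra_simps)

lemma trace_scale: "trace (\<lambda>v. c *\<^sub>R T v) = c * trace T"
  by (simp add: trace_def g_simps sum_distrib_left algebra_simps)

text \<open>Invariance of the trace: after \<open>v\<close> is expanded in the given coordinates and the sums are exchanged,
  the inner sum is the expansion of \<open>T (f i)\<close> in the orthonormal basis.\<close>

lemma trace_coordinates:
  assumes T: "linear T" and c: "\<And>i. i \<in> I \<Longrightarrow> linear (c i)"
    and expand: "\<And>x. x = (\<Sum>i\<in>I. c i x *\<^sub>R f i)"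
  shows "trace T = (\<Sum>i\<in>I. c i (T (f i)))"
proof -
  have "trace T = (\<Sum>v\<in>onb. g v v * g (T (\<Sum>i\<in>I. c i v *\<^sub>R f i)) v)"
    unfolding trace_def expand[symmetric] ..
  also have "\<dots> = (\<Sum>v\<in>onb. \<Sum>i\<in>I. g v v * g (T (f i)) v * c i v)"
    by (simp add: linear_sum[OF T] linear_cmul[OF T] linear_sum[OF linear_g_left] g_simps
        sum_distrib_left algebra_simps)
  also have "\<dots> = (\<Sum>i\<in>I. \<Sum>v\<in>onb. g v v * g (T (f i)) v * c i v)"
    by (rule sum.swap)
  also have "\<dots> = (\<Sum>i\<in>I. c i (\<Sum>v\<in>onb. (g v v * g (T (f i)) v) *\<^sub>R v))"
    by (intro sum.cong refl) (simp add: linear_sum[OF c] linear_cmul[OF c])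
  finally show ?thesis by (simp only: onb_expansion)
qed

lemma trace_commute:
  assumes S: "linear S" and T: "linear T"
  shows "trace (\<lambda>v. S (T v)) = trace (\<lambda>v. T (S v))"
proof -
  have *: "trace (\<lambda>v. S (T v)) = (\<Sum>v\<in>onb. \<Sum>u\<in>onb. g v v * g u u * g (T v) u * g (S u) v)"
    if S: "linear S" for S T
  proof -
    have "g (S (T v)) v = (\<Sum>u\<in>onb. g u u * g (T v) u * g (S u) v)" for v
    proof -
      have "g (S (T v)) v = g (S (\<Sum>u\<in>onb. (g u u * g (T v) u) *\<^sub>R u)) v"
        by (simp only: onb_expansion)
      then show ?thesis
        by (simp add: linear_sum[OF S] linear_cmul[OF S] linear_sum[OF linear_g_left] g_simps)
    qed
    then show ?thesis by (simp add: trace_def sum_distrib_left mult.assoc)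
  qed
  show ?thesis
    unfolding *[OF S] *[OF T] by (subst sum.swap) (simp only: ac_simps)
qed

text \<open>A representing vector exists because the form identifies the space with its dual.\<close>

lemma ex1_representing:
  assumes "linear f" shows "\<exists>!w. \<forall>z. g w z = f z"
proof
  have *: "g (\<Sum>v\<in>onb. (g v v * f v) *\<^sub>R v) z = f z" for z
  proof -
    have "g (\<Sum>v\<in>onb. (g v v * f v) *\<^sub>R v) z = (\<Sum>v\<in>onb. (g v v * f v) * g v z)"
      by (simp add: linear_sum[OF linear_g_left] g_simps)
    also have "\<dots> = (\<Sum>v\<in>onb. (g v v * g z v) * f v)"
    proof (intro sum.cong refl)
      fix v show "(g v v * f v) * g v z = (g v v * g z v) * f v"
        unfolding sym_g[of v z] by (simp only: ac_simps)
    qed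
    also have "\<dots> = f (\<Sum>v\<in>onb. (g v v * g z v) *\<^sub>R v)"
      by (simp add: linear_sum[OF assms] linear_cmul[OF assms])
    finally show "g (\<Sum>v\<in>onb. (g v v * f v) *\<^sub>R v) z = f z" by (simp only: onb_expansion)
  qed
  then show "\<forall>z. g (\<Sum>v\<in>onb. (g v v * f v) *\<^sub>R v) z = f z" by blast
  show "w = (\<Sum>v\<in>onb. (g v v * f v) *\<^sub>R v)" if "\<forall>z. g w z = f z" for w
    by (rule g_eqI) (simp only: * that)
qed

end

section \<open>The Ricci form of a Kaehler Lie algebra\<close>

context lie_algebra begin

lemmas br_simps = bilinear_ladd[OF bilinear_br] bilinear_radd[OF bilinear_br]
  bilinear_lmul[OF bilinear_br] bilinear_rmul[OF bilinear_br]
  bilinear_lsub[OF bilinear_br] bilinear_rsub[OF bilinear_br]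
  bilinear_lneg[OF bilinear_br] bilinear_rneg[OF bilinear_br]
  bilinear_lzero[OF bilinear_br] bilinear_rzero[OF bilinear_br]

lemma br_swap: "br y x = - br x y"
proof -
  have "br (x + y) (x + y) = 0" by (rule alternating_br)
  then have "br x y + br y x = 0" by (simp add: br_simps alternating_br[of x] alternating_br[of y] add.commute)
  then show ?thesis by (metis add.commute eq_neg_iff_add_eq_0)
qed

lemma jacobi_ad: "br (br x y) z = br x (br y z) - br y (br x z)"
proof -
  have "br (br y z) x = - br x (br y z)" "br (br z x) y = br y (br x z)"
    using br_swap[of x "br y z"] br_swap[of y "br x z"] br_swap[of z x] by (auto simp: br_simps)
  with jacobi[of x y z] show ?thesis by (simp add: algebra_simps add_eq_0_iff)
qed

lemma linear_ad: "linear (br x)"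
  using bilinear_br by (simp add: bilinear_def)

end

context complex_lie_algebra begin

lemmas J_simps = linear_add[OF linear_J] linear_diff[OF linear_J] linear_neg[OF linear_J]
  linear_cmul[OF linear_J] linear_0[OF linear_J] J_J

lemma integrable: "br (J x) (J y) = br x y + J (br (J x) y) + J (br x (J y))"
  using integrable_J[of x y] by (simp add: algebra_simps)

text \<open>The action of \<open>\<q> = {x + \<i> J x}\<close> on its complement: the component of
  \<open>[x + \<i> J x, y - \<i> J y]\<close> in the conjugate of \<open>\<q>\<close> is \<open>D x y - \<i> J (D x y)\<close>.\<close>

definition D :: "'a \<Rightarrow> 'a \<Rightarrow> 'a" where
  "D x y = br x y + J (br (J x) y)"

lemma linear_D: "linear (D x)"
  by (rule linearI) (simp_all add: D_def br_simps J_simps algebra_simps)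

end

locale finite_kaehler_lie_algebra = kaehler_lie_algebra br J \<omega>
  for br :: "'a::real_vector \<Rightarrow> 'a \<Rightarrow> 'a" and J \<omega> +
  assumes finite_dimensional: "\<exists>S::'a set. finite S \<and> span S = UNIV"
begin

abbreviation g :: "'a \<Rightarrow> 'a \<Rightarrow> real" where
  "g \<equiv> kaehler_metric J \<omega>"

lemmas \<omega>_simps = bilinear_ladd[OF bilinear_\<omega>] bilinear_radd[OF bilinear_\<omega>]
  bilinear_lmul[OF bilinear_\<omega>] bilinear_rmul[OF bilinear_\<omega>]
  bilinear_lsub[OF bilinear_\<omega>] bilinear_rsub[OF bilinear_\<omega>]
  bilinear_lneg[OF bilinear_\<omega>] bilinear_rneg[OF bilinear_\<omega>]
  bilinear_lzero[OF bilinear_\<omega>] bilinear_rzero[OF bilinear_\<omega>]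

lemma \<omega>_swap: "\<omega> y x = - \<omega> x y"
proof -
  have "\<omega> (x + y) (x + y) = 0" by (rule alternating_\<omega>)
  then show ?thesis by (simp add: \<omega>_simps alternating_\<omega>[of x] alternating_\<omega>[of y])
qed

lemma \<omega>_J_left: "\<omega> (J x) y = - \<omega> x (J y)"
  using J_invariant_\<omega>[of x "J y"] by (simp add: J_simps \<omega>_simps)

sublocale nondegenerate_form g
proof
  show "bilinear g"
    by (auto simp: bilinear_def kaehler_metric_def J_simps \<omega>_simps intro!: linearI)
  show "g x y = g y x" for x y
    using \<omega>_J_left[of x y] \<omega>_swap[of "J y" x] by (simp add: kaehler_metric_def)
  show "x = 0" if "\<And>y. g x y = 0" for x
  proof -
    have "J x = 0" by (rule nondegenerate_\<omega>) (use that in \<open>simp add: kaehler_metric_def\<close>)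
    then show ?thesis using J_J[of x] by (simp add: J_simps)
  qed
qed (rule finite_dimensional)

lemma g_J_left: "g (J x) y = - g x (J y)"
  by (simp add: kaehler_metric_def \<omega>_J_left)

abbreviation nabla :: "'a \<Rightarrow> 'a \<Rightarrow> 'a" where
  "nabla \<equiv> levi_civita br g"

lemma koszul: "2 * g (nabla x y) z = g (br x y) z - g (br y z) x + g (br z x) y"
proof -
  define f where "f z = (g (br x y) z - g (br y z) x + g (br z x) y) / 2" for z
  have "linear f"
    unfolding f_def by (rule linearI) (simp_all add: br_simps g_simps field_simps)
  then have "\<exists>!w. \<forall>z. g w z = f z" by (rule ex1_representing)
  moreover have "(\<forall>z. g w z = f z) \<longleftrightarrow>
      (\<forall>z. 2 * g w z = g (br x y) z - g (br y z) x + g (br z x) y)" for w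
    by (auto simp: f_def field_simps)
  ultimately have "\<exists>!w. \<forall>z. 2 * g w z = g (br x y) z - g (br y z) x + g (br z x) y" by simp
  from theI'[OF this] show ?thesis unfolding levi_civita_def by blast
qed

lemma bilinear_nabla: "bilinear nabla"
proof -
  have eqI: "u = v" if "\<And>z. 2 * g u z = 2 * g v z" for u v
    using that g_eqI[of u v] by simp
  have scale: "2 * (c * g u z) = c * (2 * g u z)" for c u z by simp
  show ?thesis
    unfolding bilinear_def
    by (intro conjI allI linearI; rule eqI)
      (simp_all only: g_simps distrib_left real_scaleR_def scale koszul br_simps,
       simp_all add: algebra_simps)
qed

lemmas nabla_simps = bilinear_ladd[OF bilinear_nabla] bilinear_radd[OF bilinear_nabla]
  bilinear_lmul[OF bilinear_nabla] bilinear_rmul[OF bilinear_nabla]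
  bilinear_lsub[OF bilinear_nabla] bilinear_rsub[OF bilinear_nabla]

lemma linear_nabla: "linear (nabla x)" "linear (\<lambda>v. nabla v y)"
  using bilinear_nabla by (simp_all add: bilinear_def)

lemma nabla_torsion_free: "br x y = nabla x y - nabla y x"
proof (rule g_eqI)
  fix z
  have "2 * g (nabla x y - nabla y x) z = 2 * g (br x y) z"
    using koszul[of x y z] koszul[of y x z] br_swap[of x y] br_swap[of z x] br_swap[of z y]
    by (simp add: g_simps)
  then show "g (br x y) z = g (nabla x y - nabla y x) z" by simp
qed

lemma nabla_skew: "g (nabla x y) z = - g y (nabla x z)"
  using koszul[of x y z] koszul[of x z y] br_swap[of x y] br_swap[of z x] br_swap[of z y]
    sym_g[of y "nabla x z"] by (simp add: g_simps)

lemma trace_nabla: "trace (nabla x) = 0"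
proof -
  have "g (nabla x v) v = 0" for v using nabla_skew[of x v v] sym_g[of v] by simp
  then show ?thesis by (simp add: trace_def)
qed

text \<open>Expanding both sides by the Koszul formula, the difference is a combination of \<open>d\<omega>(x, y, z)\<close>,
  \<open>d\<omega>(x, J y, J z)\<close> and the Nijenhuis tensor of \<open>y\<close> and \<open>z\<close>.\<close>

lemma nabla_J: "nabla x (J y) = J (nabla x y)"
proof (rule g_eqI)
  fix z
  have N: "\<omega> (br (J y) (J z)) x' = \<omega> (br y z) x' + \<omega> (J (br (J y) z)) x' + \<omega> (J (br y (J z))) x'" for x'
    by (simp add: integrable[of y z] \<omega>_simps)
  have "2 * g (nabla x (J y)) z + 2 * g (nabla x y) (J z) = 0"
    unfolding koszul
    using closed_\<omega>[of x y z] closed_\<omega>[of x "J y" "J z"] N[of x]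
    by (simp add: kaehler_metric_def \<omega>_J_left J_simps \<omega>_simps br_simps
      br_swap[of x] \<omega>_swap[of x])
  then show "g (nabla x (J y)) z = g (J (nabla x y)) z" by (simp add: g_J_left)
qed

text \<open>Each \<open>\<nabla>\<^sub>v y\<close> in the contracted curvature is an operator applied to \<open>v\<close>, and since \<open>\<nabla>\<close> is torsion
  free and \<open>\<nabla>\<^sub>y\<close> is skew, the trace of \<open>v \<mapsto> \<nabla>\<^sub>v y\<close> is minus that of \<open>ad y\<close>. The two traces that
  involve \<open>\<nabla>\<^sub>x\<close> as an operator cancel by cyclicity.\<close>

lemma ricci_eq:
  "ricci br g x y = - trace (br (nabla x y)) - trace (\<lambda>v. nabla (nabla v x) y)"
proof -
  have ric: "ricci br g x y = - trace (\<lambda>v. curvature br g x v y)"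
    by (simp add: ricci_def trace_def onb_def)
  have "curvature br g x v y =
      nabla x (nabla v y) - nabla v (nabla x y) - (nabla (nabla x v) y - nabla (nabla v x) y)" for v
    by (simp add: curvature_def nabla_torsion_free nabla_simps)
  then have "trace (\<lambda>v. curvature br g x v y) =
      trace (\<lambda>v. nabla x (nabla v y)) - trace (\<lambda>v. nabla v (nabla x y))
      - (trace (\<lambda>v. nabla (nabla x v) y) - trace (\<lambda>v. nabla (nabla v x) y))"
    by (simp add: trace_diff)
  also have "trace (\<lambda>v. nabla x (nabla v y)) = trace (\<lambda>v. nabla (nabla x v) y)"
    by (rule trace_commute[OF linear_nabla])
  also have "trace (\<lambda>v. nabla v (nabla x y)) = - trace (br (nabla x y))"
  proof -
    have "trace (br (nabla x y)) = trace (nabla (nabla x y)) - trace (\<lambda>v. nabla v (nabla x y))"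
      unfolding trace_diff[symmetric] nabla_torsion_free[symmetric] ..
    then show ?thesis by (simp add: trace_nabla)
  qed
  finally show ?thesis by (simp add: ric)
qed

text \<open>The familiar formula of this form is \<open>koszul_form_eq\<close>; the one by \<open>D\<close> exhibits it as an invariant of
  the action of \<open>\<q>\<close>.\<close>

definition koszul_form :: "'a \<Rightarrow> real" where
  "koszul_form x = trace (\<lambda>v. J (D x v))"

lemma koszul_form_eq: "koszul_form x = trace (\<lambda>v. J (br x v)) - trace (br (J x))"
  unfolding koszul_form_def trace_diff[symmetric] by (simp add: D_def J_simps)

lemma trace_commute_J_nabla:
  assumes "linear S"
  shows "trace (\<lambda>v. J (nabla x (S v))) = trace (\<lambda>v. J (S (nabla x v)))"
proof -
  have "trace (\<lambda>v. J (nabla x (S v))) = trace (\<lambda>v. nabla x (J (S v)))"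
    by (simp add: nabla_J)
  also have "\<dots> = trace (\<lambda>v. J (S (nabla x v)))"
    by (rule trace_commute[of "nabla x" "\<lambda>v. J (S v)"])
      (use assms linear_J linear_nabla linear_compose[of S J] in \<open>auto simp: o_def\<close>)
  finally show ?thesis .
qed

text \<open>The Ricci form is the differential of the Koszul form, up to a factor: writing \<open>\<nabla>\<^sub>v x\<close> as
  \<open>\<nabla>\<^sub>x v - [x, v]\<close> everywhere, all terms containing a \<open>\<nabla>\<^sub>x\<close> cancel because \<open>J\<close> commutes with
  \<open>\<nabla>\<^sub>x\<close>.\<close>

lemma ricci_koszul_form:
  "ricci br g x (J y) - ricci br g y (J x) = koszul_form (br x y)"
proof -
  have T: "trace (\<lambda>v. nabla (nabla v x) (J y)) =
      trace (\<lambda>v. J (nabla y (nabla x v))) - trace (\<lambda>v. J (nabla y (br x v)))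
      - trace (\<lambda>v. J (br y (nabla x v))) + trace (\<lambda>v. J (br y (br x v)))" for x y
  proof -
    have tf: "nabla v z = nabla z v - br z v" for v z
      using nabla_torsion_free[of z v] by simp
    have "nabla (nabla v x) (J y) =
      J (nabla y (nabla x v)) - J (nabla y (br x v)) - J (br y (nabla x v)) + J (br y (br x v))" for v
      by (subst nabla_J, subst tf[of "nabla v x" y], subst (1 2) tf[of v x])
        (simp add: nabla_simps br_simps J_simps)
    then show ?thesis by (simp add: trace_add trace_diff)
  qed
  have "trace (\<lambda>v. J (br (br x y) v)) = trace (\<lambda>v. J (br x (br y v))) - trace (\<lambda>v. J (br y (br x v)))"
    by (simp add: jacobi_ad J_simps trace_diff)
  moreover have "trace (br (nabla x (J y))) - trace (br (nabla y (J x))) = trace (br (J (br x y)))"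
  proof -
    have "br (nabla x (J y)) v - br (nabla y (J x)) v = br (J (br x y)) v" for v
      by (simp add: nabla_J nabla_torsion_free[of x y] J_simps br_simps)
    then show ?thesis by (simp add: trace_diff[symmetric])
  qed
  ultimately show ?thesis
    using trace_commute_J_nabla[OF linear_nabla(1), of x y]
      trace_commute_J_nabla[OF linear_ad, of x y] trace_commute_J_nabla[OF linear_ad, of y x]
    by (simp add: ricci_eq T koszul_form_eq)
qed

text \<open>The metric is \<open>J\<close>-invariant, hence so is the Ricci tensor of an Einstein metric; this makes the
  left hand side of the preceding lemma a multiple of \<open>\<omega>\<close>. Being not Ricci flat provides the factor that
  is divided by.\<close>

theorem einstein_exact:
  assumes "einstein br g" "\<not> ricci_flat br g"
  shows "\<exists>\<kappa>. \<forall>x y. \<omega> x y = \<kappa> * koszul_form (br x y)"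
proof -
  obtain \<nu> where \<nu>: "\<And>x y. ricci br g x y = \<nu> * g x y"
    using assms by (auto simp: einstein_def)
  with assms have "\<nu> \<noteq> 0" by (auto simp: ricci_flat_def)
  have "koszul_form (br x y) = 2 * \<nu> * \<omega> x y" for x y
  proof -
    have "\<omega> (J y) (J x) = - \<omega> x y" using J_invariant_\<omega>[of x y] \<omega>_swap[of "J x" "J y"] by simp
    then show ?thesis
      using ricci_koszul_form[of x y] J_invariant_\<omega>[of x y] by (simp add: \<nu> kaehler_metric_def)
  qed
  then have "\<omega> x y = 1 / (2 * \<nu>) * koszul_form (br x y)" for x y using \<open>\<nu> \<noteq> 0\<close> by simp
  then show ?thesis by blast
qed

end

section \<open>Two-dimensional complex data\<close>

context complex_lie_algebra begin

definition cscale :: "complex \<Rightarrow> 'a \<Rightarrow> 'a" (infixr "\<cdot>" 75) where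
  "z \<cdot> v = Re z *\<^sub>R v + Im z *\<^sub>R J v"

sublocale C: vector_space cscale
  by unfold_locales
    (simp_all add: cscale_def J_simps algebra_simps)

lemma i_cscale: "\<i> \<cdot> v = J v"
  by (simp add: cscale_def)

lemma of_real_cscale: "of_real r \<cdot> v = r *\<^sub>R v"
  by (simp add: cscale_def)

lemma J_cscale: "J (z \<cdot> v) = (\<i> * z) \<cdot> v"
  by (simp add: cscale_def J_simps)

text \<open>The bracket of \<open>\<q>\<close>: it is \<open>x \<star> y + \<i> J (x \<star> y)\<close> on \<open>x + \<i> J x\<close> and \<open>y + \<i> J y\<close>.\<close>

definition star :: "'a \<Rightarrow> 'a \<Rightarrow> 'a" (infixl "\<star>" 70) where
  "x \<star> y = br x y - br (J x) (J y)"

lemma two_br: "2 *\<^sub>R br x y = x \<star> y + D x y - D y x"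
  using integrable[of x y] br_swap[of x y] br_swap[of x "J y"]
  by (simp add: star_def D_def scaleR_2 J_simps)

lemma D_J: "D x (J y) = J (D x y)" "D (J x) y = - J (D x y)"
  using integrable[of x y] by (simp_all add: D_def J_simps br_simps)

lemma star_J: "x \<star> J y = J (x \<star> y)" "J x \<star> y = J (x \<star> y)"
  using integrable[of x y] by (simp_all add: star_def J_simps br_simps)

lemma star_simps:
  "(x + y) \<star> z = x \<star> z + y \<star> z" "x \<star> (y + z) = x \<star> y + x \<star> z"
  "(w \<cdot> x) \<star> z = w \<cdot> (x \<star> z)" "x \<star> (w \<cdot> z) = w \<cdot> (x \<star> z)"
  "x \<star> 0 = 0" "0 \<star> x = 0" "x \<star> x = 0"
  "(- x) \<star> z = - (x \<star> z)" "x \<star> (- z) = - (x \<star> z)"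
  "(x - y) \<star> z = x \<star> z - y \<star> z" "x \<star> (y - z) = x \<star> y - x \<star> z"
proof -
  have scale: "(r *\<^sub>R x) \<star> y = r *\<^sub>R (x \<star> y)" "x \<star> (r *\<^sub>R y) = r *\<^sub>R (x \<star> y)" for r x y
    by (simp_all add: star_def J_simps br_simps algebra_simps)
  show add: "(x + y) \<star> z = x \<star> z + y \<star> z" "x \<star> (y + z) = x \<star> y + x \<star> z" for x y z
    by (simp_all add: star_def J_simps br_simps algebra_simps)
  show "(w \<cdot> x) \<star> z = w \<cdot> (x \<star> z)" "x \<star> (w \<cdot> z) = w \<cdot> (x \<star> z)"
    by (simp_all add: cscale_def scale add star_J)
qed (simp_all add: star_def br_simps J_simps alternating_br)

lemma star_swap: "y \<star> x = - (x \<star> y)"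
  using br_swap[of x y] br_swap[of "J x" "J y"] by (simp add: star_def)

lemma D_simps:
  "D (x + y) z = D x z + D y z" "D x (y + z) = D x y + D x z"
  "D (w \<cdot> x) z = cnj w \<cdot> D x z" "D x (w \<cdot> z) = w \<cdot> D x z"
  "D x 0 = 0" "D 0 x = 0"
  "D (- x) z = - D x z" "D x (- z) = - D x z"
  "D (x - y) z = D x z - D y z" "D x (y - z) = D x y - D x z"
proof -
  have scale: "D (r *\<^sub>R x) y = r *\<^sub>R D x y" "D x (r *\<^sub>R y) = r *\<^sub>R D x y" for r x y
    by (simp_all add: D_def J_simps br_simps algebra_simps)
  show add: "D (x + y) z = D x z + D y z" "D x (y + z) = D x y + D x z" for x y z
    by (simp_all add: D_def J_simps br_simps algebra_simps)
  show "D (w \<cdot> x) z = cnj w \<cdot> D x z" "D x (w \<cdot> z) = w \<cdot> D x z"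
    by (simp_all add: cscale_def scale add D_J)
qed (simp_all add: D_def br_simps J_simps)

text \<open>Integrability for \<open>x\<close> and \<open>[J y, z]\<close> moves every \<open>J\<close> in \<open>D x (D y z)\<close> to the outside; after
  alternation in \<open>x\<close> and \<open>y\<close>, the Jacobi identity applies inside each \<open>J\<close>.\<close>

lemma D_star: "D (x \<star> y) z = D x (D y z) - D y (D x z)"
proof -
  have DD: "D x (D y z) = br x (br y z) + J (br (J x) (br y z)) + J (br x (br (J y) z))
      - br (J x) (br (J y) z)" for x y
    using integrable[of x "br (J y) z"] by (simp add: D_def br_simps J_simps algebra_simps)
  have Jstar: "J (x \<star> y) = br (J x) y + br x (J y)"
    unfolding star_J(2)[symmetric] by (simp add: star_def br_simps J_simps)
  show ?thesis
    unfolding DD unfolding D_def Jstar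
    by (simp add: star_def br_simps J_simps jacobi_ad)
qed

text \<open>This is the \<open>\<q>\<close>-component of the Jacobi identity for two arguments in \<open>\<q>\<close> and one in the
  conjugate; \<open>D_star\<close> is the other component. The Jacobi identity is a sum of an expression linear in all arguments and three
  expressions antilinear in one of them; replacing \<open>z\<close> by \<open>J z\<close> isolates the one antilinear in \<open>z\<close>.\<close>

lemma D_on_star: "D z (x \<star> y) = D (D y z) x + x \<star> D z y - D (D x z) y - y \<star> D z x"
proof -
  define L where "L x y z = (x \<star> y) \<star> z + (y \<star> z) \<star> x + (z \<star> x) \<star> y" for x y z
  define F where "F x y z = D (D y z) x + x \<star> D z y - D (D x z) y - y \<star> D z x - D z (x \<star> y)" for x y z
  have sum: "L x y z + F x y z + F y z x + F z x y = 0" for x y z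
  proof -
    have four: "4 *\<^sub>R br (br x y) z = (x \<star> y + D x y - D y x) \<star> z + D (x \<star> y + D x y - D y x) z
        - D z (x \<star> y + D x y - D y x)" for x y z
      by (simp add: two_br[symmetric] br_simps)
    have "4 *\<^sub>R br (br x y) z + 4 *\<^sub>R br (br y z) x + 4 *\<^sub>R br (br z x) y = 0"
      using jacobi[of x y z] by (simp add: scaleR_add_right[symmetric])
    then show ?thesis
      unfolding four L_def F_def
      by (simp add: D_simps D_star star_simps star_swap[where y = "D u v" for u v] algebra_simps)
  qed
  have "L x y (J z) = J (L x y z)" "F x y (J z) = - J (F x y z)"
    "F y (J z) x = J (F y z x)" "F (J z) x y = J (F z x y)"
    by (simp_all add: L_def F_def D_J star_J J_simps star_simps D_simps)
  then have "J (L x y z) - J (F x y z) + J (F y z x) + J (F z x y) = 0"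
    using sum[of x y "J z"] by simp
  then have "J (L x y z - F x y z + F y z x + F z x y) = J 0"
    by (simp add: J_simps)
  then have "L x y z - F x y z + F y z x + F z x y = 0"
    using J_J by (metis neg_equal_iff_equal)
  with sum[of x y z] have "2 *\<^sub>R F x y z = 0"
    by (simp add: scaleR_2 algebra_simps eq_neg_iff_add_eq_0)
  then have "F x y z = 0" by simp
  then show ?thesis by (simp add: F_def algebra_simps)
qed

definition cbasis :: "'a \<Rightarrow> 'a \<Rightarrow> bool" where
  "cbasis a b \<longleftrightarrow> (\<forall>v. \<exists>z w. v = z \<cdot> a + w \<cdot> b) \<and> (\<forall>z w. z \<cdot> a + w \<cdot> b = 0 \<longrightarrow> z = 0 \<and> w = 0)"

lemma cbasis_coords: "cbasis a b \<Longrightarrow> \<exists>z w. v = z \<cdot> a + w \<cdot> b"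
  by (simp add: cbasis_def)

lemma cbasis_zero: "cbasis a b \<Longrightarrow> z \<cdot> a + w \<cdot> b = 0 \<longleftrightarrow> z = 0 \<and> w = 0"
  by (auto simp: cbasis_def)

lemma cbasis_eq: "cbasis a b \<Longrightarrow> z \<cdot> a + w \<cdot> b = z' \<cdot> a + w' \<cdot> b \<longleftrightarrow> z = z' \<and> w = w'"
  using cbasis_zero[of a b "z - z'" "w - w'"] by (auto simp: algebra_simps C.scale_left_diff_distrib)

lemma cbasis_nonzero: "cbasis a b \<Longrightarrow> a \<noteq> 0" "cbasis a b \<Longrightarrow> b \<noteq> 0"
  using cbasis_zero[of a b 1 0] cbasis_zero[of a b 0 1] by auto

lemma cbasis_swap: "cbasis a b \<Longrightarrow> cbasis b a"
  unfolding cbasis_def by (metis add.commute)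

lemma cbasis_scale:
  assumes "cbasis a b" "u \<noteq> 0" "v \<noteq> 0" shows "cbasis (u \<cdot> a) (v \<cdot> b)"
  unfolding cbasis_def
proof (intro conjI allI impI)
  fix x
  obtain z w where "x = z \<cdot> a + w \<cdot> b" using cbasis_coords[OF assms(1)] by blast
  then have "x = (z / u) \<cdot> u \<cdot> a + (w / v) \<cdot> v \<cdot> b" using assms by simp
  then show "\<exists>z w. x = z \<cdot> u \<cdot> a + w \<cdot> v \<cdot> b" by blast
next
  fix z w assume "z \<cdot> u \<cdot> a + w \<cdot> v \<cdot> b = 0"
  with cbasis_zero[OF assms(1)] assms show "z = 0" "w = 0" by auto
qed

lemma cbasis_shear:
  assumes "cbasis a b" shows "cbasis a (b + s \<cdot> a)"
  unfolding cbasis_def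
proof (intro conjI allI impI)
  fix x
  obtain z w where "x = z \<cdot> a + w \<cdot> b" using cbasis_coords[OF assms(1)] by blast
  then have "x = (z - w * s) \<cdot> a + w \<cdot> (b + s \<cdot> a)" by (simp add: algebra_simps C.scale_left_diff_distrib C.scale_right_distrib)
  then show "\<exists>z w. x = z \<cdot> a + w \<cdot> (b + s \<cdot> a)" by blast
next
  fix z w assume "z \<cdot> a + w \<cdot> (b + s \<cdot> a) = 0"
  then have "(z + w * s) \<cdot> a + w \<cdot> b = 0" by (simp add: algebra_simps C.scale_left_distrib C.scale_right_distrib)
  with cbasis_zero[OF assms(1)] assms show "z = 0" "w = 0" by auto
qed

definition clinear :: "('a \<Rightarrow> 'a) \<Rightarrow> bool" where
  "clinear T \<longleftrightarrow> (\<forall>x y. T (x + y) = T x + T y) \<and> (\<forall>z x. T (z \<cdot> x) = z \<cdot> T x)"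

lemma clinear_D: "clinear (D x)"
  by (simp add: clinear_def D_simps)

lemma clinear_coords: "clinear T \<Longrightarrow> T (z \<cdot> a + w \<cdot> b) = z \<cdot> T a + w \<cdot> T b"
  by (simp add: clinear_def)

lemma ex_eigenvector:
  assumes "cbasis a b" "clinear T" shows "\<exists>f l. f \<noteq> 0 \<and> T f = l \<cdot> f"
proof -
  obtain p q where Ta: "T a = p \<cdot> a + q \<cdot> b" using cbasis_coords[OF assms(1)] by blast
  obtain r s where Tb: "T b = r \<cdot> a + s \<cdot> b" using cbasis_coords[OF assms(1)] by blast
  show ?thesis
  proof (cases "q = 0")
    case True
    with Ta cbasis_nonzero[OF assms(1)] show ?thesis by auto
  next
    case False
    \<comment> \<open>\<open>l\<close> is a root of the characteristic polynomial.\<close>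
    define l where "l = (p + s + csqrt ((p - s)\<^sup>2 + 4 * q * r)) / 2"
    have "(2 * l - (p + s))\<^sup>2 = (p - s)\<^sup>2 + 4 * q * r"
    proof -
      have "2 * l - (p + s) = csqrt ((p - s)\<^sup>2 + 4 * q * r)" by (simp add: l_def field_simps)
      then show ?thesis by (simp only: power2_csqrt)
    qed
    then have "4 * ((l - p) * (l - s)) = 4 * (q * r)"
      by (simp add: power2_eq_square algebra_simps)
    then have l: "(l - p) * (l - s) = q * r" by simp
    define f where "f = (l - s) \<cdot> a + q \<cdot> b"
    have "T f = (p * (l - s) + q * r) \<cdot> a + ((l - s) * q + q * s) \<cdot> b"
      unfolding f_def clinear_coords[OF assms(2)] Ta Tb
      by (simp add: C.scale_left_distrib C.scale_right_distrib algebra_simps)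
    also have "p * (l - s) + q * r = l * (l - s)"
      using l by (simp add: algebra_simps)
    also have "(l - s) * q + q * s = l * q" by (simp add: algebra_simps)
    finally have "T f = l \<cdot> f" by (simp add: f_def C.scale_right_distrib)
    moreover have "f \<noteq> 0" using cbasis_zero[OF assms(1)] False by (auto simp: f_def)
    ultimately show ?thesis by blast
  qed
qed

end

locale complex_lie_algebra_4 = complex_lie_algebra br J
  for br :: "'a::real_vector \<Rightarrow> 'a \<Rightarrow> 'a" and J +
  assumes dim_4: "dim (UNIV :: 'a set) = 4"
begin

text \<open>Complex independence of \<open>a\<close> and \<open>b\<close> makes \<open>(z, w) \<mapsto> z a + w b\<close> injective, and both sides have
  real dimension four.\<close>

lemma cbasisI:
  assumes "a \<noteq> 0" and b: "\<And>z. b \<noteq> z \<cdot> a" shows "cbasis a b"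
proof -
  have zero: "z = 0 \<and> w = 0" if "z \<cdot> a + w \<cdot> b = 0" for z w
  proof -
    have "w = 0"
    proof (rule ccontr)
      assume "w \<noteq> 0"
      have "w \<cdot> b = (- z) \<cdot> a" using that by (simp add: add_eq_0_iff)
      then have "(1 / w) \<cdot> w \<cdot> b = (- z / w) \<cdot> a" by simp
      then have "b = (- z / w) \<cdot> a" using \<open>w \<noteq> 0\<close> by (simp only: C.scale_scale) simp
      with b show False by blast
    qed
    with that have "z \<cdot> a = 0" by simp
    with \<open>w = 0\<close> \<open>a \<noteq> 0\<close> show ?thesis by simp
  qed
  define F :: "complex \<times> complex \<Rightarrow> 'a" where "F p = fst p \<cdot> a + snd p \<cdot> b" for p
  have linF: "linear F"
    by (rule linearI)
      (simp_all add: F_def C.scale_left_distrib C.scale_right_distrib cscale_def algebra_simps)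
  have inj: "inj F"
    unfolding linear_injective_0[OF linF] using zero by (auto simp: F_def prod_eq_iff)
  define X where "X = F ` Basis"
  have indX: "independent X"
    unfolding X_def
    by (rule linear_independent_injective_image[OF linF independent_Basis])
      (use inj in \<open>auto intro: inj_on_subset\<close>)
  have "card X = DIM(complex \<times> complex)"
    unfolding X_def by (rule card_image) (use inj in \<open>auto intro: inj_on_subset\<close>)
  then have cardX: "card X = 4" by simp
  obtain S :: "'a set" where S: "independent S" "UNIV \<subseteq> span S" "card S = 4"
    using basis_exists[of "UNIV :: 'a set"] dim_4 by metis
  then have finS: "finite S" by (metis card.infinite zero_neq_numeral)
  have "v \<in> span X" for v
  proof (rule ccontr)
    assume v: "v \<notin> span X"
    then have "independent (insert v X)" using indX by (simp add: independent_insertI)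
    then have "card (insert v X) \<le> 4" using independent_span_bound[OF finS] S by auto
    moreover have "finite X" using cardX by (metis card.infinite zero_neq_numeral)
    ultimately show False using v cardX span_base[of v X] by (simp add: card_insert_if split: if_splits)
  qed
  then have "v \<in> range F" for v
    unfolding X_def linear_span_image[OF linF] by simp
  then have "\<exists>z w. v = z \<cdot> a + w \<cdot> b" for v
    by (fastforce simp: F_def image_iff)
  with zero show ?thesis by (simp add: cbasis_def)
qed

text \<open>Otherwise the space would be a complex line, of real dimension at most two.\<close>

lemma cbasis_extend: "a \<noteq> 0 \<Longrightarrow> \<exists>b. cbasis a b"
proof (rule ccontr)
  assume a: "a \<noteq> 0" and no: "\<nexists>b. cbasis a b"
  then have "\<exists>z. b = z \<cdot> a" for b using cbasisI[of a] by blast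
  moreover have "z \<cdot> a \<in> span {a, J a}" for z
    unfolding cscale_def by (intro span_add span_scale span_base) auto
  ultimately have "b \<in> span {a, J a}" for b by metis
  then have "dim (UNIV :: 'a set) \<le> card {a, J a}"
    by (intro dim_le_card) auto
  also have "\<dots> \<le> 2" by (simp add: card_insert_if)
  finally show False by (simp add: dim_4)
qed

lemma ex_cbasis: "\<exists>a b. cbasis a b"
proof -
  have "\<exists>a::'a. a \<noteq> 0"
  proof (rule ccontr)
    assume "\<not> ?thesis"
    then have "UNIV \<subseteq> span ({} :: 'a set)" by auto
    then have "dim (UNIV :: 'a set) \<le> card ({} :: 'a set)" by (intro dim_le_card) auto
    then show False by (simp add: dim_4)
  qed
  then show ?thesis using cbasis_extend by blast
qed

text \<open>If an eigenvector \<open>f\<close> of \<open>T\<close> is not one of \<open>S\<close>, then \<open>f\<close> and \<open>S f\<close> form a basis of eigenvectors of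
  \<open>T\<close> for the same eigenvalue. So \<open>T\<close> is scalar and any eigenvector of \<open>S\<close> will do.\<close>

lemma ex_common_eigenvector:
  assumes T: "clinear T" and S: "clinear S" and commute: "\<And>v. T (S v) = S (T v)"
  shows "\<exists>f l \<mu>. f \<noteq> 0 \<and> T f = l \<cdot> f \<and> S f = \<mu> \<cdot> f"
proof -
  obtain a b where ab: "cbasis a b" using ex_cbasis by blast
  obtain f l where f: "f \<noteq> 0" "T f = l \<cdot> f" using ex_eigenvector[OF ab T] by blast
  show ?thesis
  proof (cases "\<exists>\<mu>. S f = \<mu> \<cdot> f")
    case True with f show ?thesis by blast
  next
    case False
    then have fS: "cbasis f (S f)" using f by (intro cbasisI) auto
    have "T (S f) = l \<cdot> S f" using commute[of f] f S by (simp add: clinear_def)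
    then have "T v = l \<cdot> v" for v
      using cbasis_coords[OF fS, of v] f by (auto simp: clinear_coords[OF T] C.scale_right_distrib mult.commute)
    moreover obtain h \<mu> where "h \<noteq> 0" "S h = \<mu> \<cdot> h" using ex_eigenvector[OF ab S] by blast
    ultimately show ?thesis by blast
  qed
qed

end

text \<open>The data left after the reduction: \<open>\<theta>\<close> is a multiple of the Koszul form, described by the
  complex trace of \<open>D x\<close> in any basis, and \<open>\<theta>([x, y])\<close> is the Kaehler form.\<close>

locale koszul_surface = complex_lie_algebra_4 br J
  for br :: "'a::real_vector \<Rightarrow> 'a \<Rightarrow> 'a" and J +
  fixes \<theta> :: "'a \<Rightarrow> real" and \<kappa> :: real
  assumes linear_\<theta>: "linear \<theta>"
    and nondegenerate_\<theta>: "(\<And>y. \<theta> (br x y) = 0) \<Longrightarrow> x = 0"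
    and J_invariant_\<theta>: "\<theta> (br (J x) (J y)) = \<theta> (br x y)"
    and \<theta>_trace: "cbasis a b \<Longrightarrow> D x a = p \<cdot> a + q \<cdot> b \<Longrightarrow> D x b = r \<cdot> a + s \<cdot> b \<Longrightarrow>
      \<theta> x = \<kappa> * Im (p + s)"
begin

lemmas \<theta>_simps = linear_add[OF linear_\<theta>] linear_diff[OF linear_\<theta>] linear_cmul[OF linear_\<theta>]
  linear_neg[OF linear_\<theta>] linear_0[OF linear_\<theta>]

lemma \<theta>_cscale:
  assumes "cbasis a b" "D x a = p \<cdot> a + q \<cdot> b" "D x b = r \<cdot> a + s \<cdot> b"
  shows "\<theta> (z \<cdot> x) = \<kappa> * Im (cnj z * (p + s))"
  using \<theta>_trace[OF assms(1), of "z \<cdot> x" "cnj z * p" "cnj z * q" "cnj z * r" "cnj z * s"]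
  by (simp add: D_simps assms C.scale_right_distrib algebra_simps)

text \<open>The Koszul form is a character of \<open>\<q>\<close>; in terms of the Kaehler form this is its \<open>J\<close>-invariance.\<close>

lemma \<theta>_star: "\<theta> (x \<star> y) = 0"
  by (simp add: star_def \<theta>_simps J_invariant_\<theta>)

lemma \<theta>_br: "2 * \<theta> (br x y) = \<theta> (D x y) - \<theta> (D y x)"
proof -
  have "\<theta> (2 *\<^sub>R br x y) = \<theta> (D x y) - \<theta> (D y x)"
    unfolding two_br by (simp add: \<theta>_simps \<theta>_star)
  then show ?thesis by (simp add: \<theta>_simps)
qed

text \<open>A vector \<open>a\<close> whose products all lie in a complex line on which \<open>\<theta>\<close> vanishes would be in the
  radical of \<open>\<theta> \<circ> [\<cdot>, \<cdot>]\<close>.\<close>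

lemma degenerate:
  assumes ab: "cbasis a b" and c: "\<And>z. \<theta> (z \<cdot> c) = 0"
    and "D a a = p \<cdot> c" "D a b = q \<cdot> c" "D b a = r \<cdot> c"
  shows False
proof -
  have "\<theta> (br a y) = 0" for y
  proof -
    obtain z w where y: "y = z \<cdot> a + w \<cdot> b" using cbasis_coords[OF ab] by blast
    have "2 * \<theta> (br a y) = 0"
      unfolding \<theta>_br y by (simp add: D_simps assms(3-) \<theta>_simps c)
    then show ?thesis by simp
  qed
  then show False using nondegenerate_\<theta> cbasis_nonzero[OF ab] by blast
qed

section \<open>Normal forms\<close>

lemma \<kappa>_nonzero: "\<kappa> \<noteq> 0"
proof
  assume "\<kappa> = 0"
  obtain a b where ab: "cbasis a b" using ex_cbasis by blast
  have "\<theta> x = 0" for x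
    using \<theta>_trace[OF ab] cbasis_coords[OF ab] \<open>\<kappa> = 0\<close> by (metis mult_zero_left)
  then show False using nondegenerate_\<theta> cbasis_nonzero[OF ab] by blast
qed

text \<open>The three multiplication tables. They belong to \<open>\<aa>\<ff>\<ff>(\<real>) \<times> \<aa>\<ff>\<ff>(\<real>)\<close>, to \<open>\<aa>\<ff>\<ff>(\<complex>)\<close>, and to the extensions
  of the Heisenberg algebra, in this order. In the last one \<open>[b, J b] = \<rho> J a\<close>, and \<open>ad a\<close> acts on the
  complex line of \<open>b\<close> as one half plus the infinitesimal rotation \<open>- \<tau> J\<close>.\<close>

definition diagonal_form :: "'a \<Rightarrow> 'a \<Rightarrow> bool" where
  "diagonal_form a b \<longleftrightarrow> cbasis a b \<and> a \<star> b = 0 \<and>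
     D a a = a \<and> D b b = b \<and> D a b = 0 \<and> D b a = 0"

definition crossed_form :: "'a \<Rightarrow> 'a \<Rightarrow> bool" where
  "crossed_form a b \<longleftrightarrow> cbasis a b \<and> a \<star> b = 0 \<and>
     D a a = 0 \<and> D b b = 0 \<and> D a b = b \<and> D b a = a"

definition heisenberg_form :: "real \<Rightarrow> real \<Rightarrow> 'a \<Rightarrow> 'a \<Rightarrow> bool" where
  "heisenberg_form \<rho> \<tau> a b \<longleftrightarrow> cbasis a b \<and> a \<star> b = Complex (1/2) (- \<tau>) \<cdot> b \<and> \<rho> \<noteq> 0 \<and>
     D a a = a \<and> D a b = Complex (1/2) (- \<tau>) \<cdot> b \<and> D b a = 0 \<and> D b b = \<rho> *\<^sub>R a"

lemmas C_simps = C.scale_left_distrib C.scale_right_distrib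

text \<open>A common eigenvector \<open>f\<close> makes all \<open>D x\<close> triangular in a basis \<open>f, h\<close>. If \<open>D f f\<close> is a nonzero multiple
  of \<open>f\<close>, the antilinearity of \<open>D\<close> in its first argument allows one to shear \<open>h\<close> so that
  \<open>D h f = 0\<close>, and the identities of commutation and compatibility force the diagonal table. If
  \<open>D f f = 0\<close>, nondegeneracy requires \<open>D f h\<close> to have a component along \<open>h\<close>, the same shear removes the
  component of \<open>D h h\<close> along \<open>h\<close>, and the crossed table results.\<close>

lemma abelian_normal_form:
  assumes star: "\<And>x y. x \<star> y = 0"
  shows "\<exists>a b. diagonal_form a b \<or> crossed_form a b"
proof -
  have commute: "D x (D y z) = D y (D x z)" for x y z
    using D_star[of x y z] star by (simp add: D_simps)
  have cocycle: "D (D y z) x = D (D x z) y" for x y z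
    using D_on_star[of z x y] star by (simp add: D_simps)
  obtain a b where ab: "cbasis a b" using ex_cbasis by blast
  have "\<exists>f \<mu> \<nu>. f \<noteq> 0 \<and> D a f = \<mu> \<cdot> f \<and> D b f = \<nu> \<cdot> f"
    by (rule ex_common_eigenvector[OF clinear_D clinear_D], rule commute)
  then obtain f \<mu> \<nu> where f: "f \<noteq> 0" "D a f = \<mu> \<cdot> f" "D b f = \<nu> \<cdot> f"
    by blast
  have eigen: "\<exists>l. D x f = l \<cdot> f" for x
  proof -
    obtain z w where "x = z \<cdot> a + w \<cdot> b" using cbasis_coords[OF ab] by blast
    then have "D x f = (cnj z * \<mu> + cnj w * \<nu>) \<cdot> f" by (simp add: D_simps f C_simps)
    then show ?thesis by blast
  qed
  obtain h0 where fh0: "cbasis f h0" using cbasis_extend[OF f(1)] by blast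
  obtain p where p: "D f f = p \<cdot> f" using eigen by blast
  obtain r where r: "D h0 f = r \<cdot> f" using eigen by blast
  obtain \<nu>0 q0 where q0: "D f h0 = \<nu>0 \<cdot> f + q0 \<cdot> h0" using cbasis_coords[OF fh0] by blast
  obtain m0 s0 where s0: "D h0 h0 = m0 \<cdot> f + s0 \<cdot> h0" using cbasis_coords[OF fh0] by blast
  show ?thesis
  proof (cases "p = 0")
    case False
    \<comment> \<open>This shear annihilates \<open>D h f = (r - (r / p) p) f\<close>.\<close>
    define h where "h = h0 + cnj (- r / p) \<cdot> f"
    have fh: "cbasis f h" unfolding h_def by (rule cbasis_shear[OF fh0])
    have hf: "D h f = 0" using False by (simp add: h_def D_simps r p)
    have "cnj p \<cdot> D f h = 0"
      using cocycle[where x = f and y = h and z = f] by (simp add: hf p D_simps)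
    then have "D f h = 0" using False by simp
    obtain m s where hh: "D h h = m \<cdot> f + s \<cdot> h" using cbasis_coords[OF fh] by blast
    have "(m * p) \<cdot> f = 0"
      using commute[where x = f and y = h and z = h] by (simp add: hh \<open>D f h = 0\<close> p D_simps)
    then have "m = 0" using False f(1) by simp
    have "s \<noteq> 0"
    proof
      assume "s = 0"
      show False
        by (rule degenerate[OF cbasis_swap[OF fh], of 0 0 0 0])
          (simp_all add: hh hf \<open>m = 0\<close> \<open>s = 0\<close> \<open>D f h = 0\<close> \<theta>_simps)
    qed
    have "diagonal_form ((1 / cnj p) \<cdot> f) ((1 / cnj s) \<cdot> h)"
      unfolding diagonal_form_def
      using False \<open>s \<noteq> 0\<close> cbasis_scale[OF fh, of "1 / cnj p" "1 / cnj s"]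
      by (simp add: star D_simps p hh hf \<open>m = 0\<close> \<open>D f h = 0\<close>)
    then show ?thesis by blast
  next
    case True
    then have ff: "D f f = 0" using p by simp
    show ?thesis
    proof (cases "q0 = 0")
      case True
      have "\<theta> (z \<cdot> f) = 0" for z
        using \<theta>_cscale[OF fh0, of f 0 0 \<nu>0 0] by (simp add: ff q0 True)
      then have False
        using degenerate[OF fh0, of f 0 \<nu>0 r] by (simp add: ff q0 r True)
      then show ?thesis ..
    next
      case False
      \<comment> \<open>This shear annihilates the coefficient \<open>s0 - (s0 / q0) q0\<close> of \<open>h\<close> in \<open>D h h\<close>.\<close>
      define h where "h = h0 + cnj (- s0 / q0) \<cdot> f"
      have fh: "cbasis f h" unfolding h_def by (rule cbasis_shear[OF fh0])
      have hf: "D h f = r \<cdot> f" by (simp add: h_def D_simps r ff)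
      define n where "n = \<nu>0 + q0 * cnj (s0 / q0)"
      have fhh: "D f h = n \<cdot> f + q0 \<cdot> h"
        by (simp add: h_def D_simps ff q0 n_def C_simps C.scale_right_diff_distrib)
      obtain m where hh: "D h h = m \<cdot> f"
      proof -
        have "D h h = (m0 - (s0 / q0) * \<nu>0 + cnj (- s0 / q0) * r) \<cdot> f"
          using False by (simp add: h_def D_simps q0 s0 r ff C_simps algebra_simps C.scale_left_diff_distrib)
        then show ?thesis using that by blast
      qed
      have "(cnj n * n + cnj q0 * m) \<cdot> f + (cnj n * q0) \<cdot> h = 0"
        using cocycle[where x = f and y = h and z = h]
        by (simp add: hh fhh ff D_simps C_simps algebra_simps)
      then have nm: "n = 0" "m = 0"
        using False by (auto simp: cbasis_zero[OF fh])
      have "r \<noteq> 0"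
      proof
        assume "r = 0"
        have "\<theta> (z \<cdot> h) = 0" for z
          using \<theta>_cscale[OF fh, of h 0 0 0 0] by (simp add: hf hh nm \<open>r = 0\<close>)
        then show False
          using degenerate[OF cbasis_swap[OF fh], of h 0 0 q0] by (simp add: hf hh fhh nm \<open>r = 0\<close>)
      qed
      have "crossed_form ((1 / cnj q0) \<cdot> f) ((1 / cnj r) \<cdot> h)"
        unfolding crossed_form_def
        using False \<open>r \<noteq> 0\<close> cbasis_scale[OF fh, of "1 / cnj q0" "1 / cnj r"]
        by (simp add: star D_simps ff fhh hh hf nm)
      then show ?thesis by blast
    qed
  qed
qed

text \<open>The usual basis of the two-dimensional nonabelian complex Lie algebra.\<close>

lemma nonabelian_cbasis:
  assumes "x \<star> y \<noteq> 0" shows "\<exists>a b. cbasis a b \<and> a \<star> b = b"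
proof -
  obtain a b where ab: "cbasis a b" using ex_cbasis by blast
  define c where "c = a \<star> b"
  have multiple: "\<exists>z. x \<star> y = z \<cdot> c" for x y
  proof -
    obtain z w z' w' where "x = z \<cdot> a + w \<cdot> b" "y = z' \<cdot> a + w' \<cdot> b"
      using cbasis_coords[OF ab] by metis
    then have "x \<star> y = (z * w' - w * z') \<cdot> c"
      by (simp add: star_simps star_swap[of a b] c_def C.scale_left_diff_distrib mult.commute)
    then show ?thesis by blast
  qed
  with assms have "c \<noteq> 0" by fastforce
  obtain z w where c: "c = z \<cdot> a + w \<cdot> b" using cbasis_coords[OF ab] by blast
  have "\<exists>d. d \<star> c = c"
  proof (cases "w = 0")
    case True
    then have "z \<noteq> 0" using c \<open>c \<noteq> 0\<close> by auto
    moreover have "b \<star> c = - (z \<cdot> c)"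
      by (subst c) (simp add: True star_simps star_swap[of a b] c_def)
    ultimately have "((- 1 / z) \<cdot> b) \<star> c = c" by (simp add: star_simps)
    then show ?thesis by blast
  next
    case False
    have "a \<star> c = w \<cdot> c"
      by (subst c) (simp add: star_simps c_def)
    then have "((1 / w) \<cdot> a) \<star> c = c" using False by (simp add: star_simps)
    then show ?thesis by blast
  qed
  then obtain d where d: "d \<star> c = c" by blast
  have "d \<noteq> z \<cdot> c" for z
  proof
    assume "d = z \<cdot> c"
    with d \<open>c \<noteq> 0\<close> show False by (simp add: star_simps)
  qed
  then have "cbasis d c" using cbasis_swap[OF cbasisI] \<open>c \<noteq> 0\<close> by blast
  with d show ?thesis by blast
qed

text \<open>By \<open>[D a, D b] = D b\<close>, the traces of \<open>D b\<close> and of its square vanish, so \<open>D b\<close> is nilpotent. If it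
  annihilates \<open>b\<close>, then all products of \<open>b\<close> lie in its complex line and \<open>b\<close> is in the radical; this
  includes the case \<open>D b = 0\<close>, in which the compatibility of \<open>D\<close> and \<open>\<star>\<close> shows \<open>D a b\<close> to be a multiple
  of \<open>b\<close>. Otherwise the kernel of \<open>D b\<close> contains some \<open>a'\<close> that differs from \<open>a\<close> by a multiple of
  \<open>b\<close>.\<close>

lemma nonabelian_adapted_cbasis:
  assumes ab: "cbasis a b" and star: "a \<star> b = b"
  shows "\<exists>a' r. cbasis a' b \<and> a' \<star> b = b \<and> D b a' = 0 \<and> D b b = r \<cdot> a' \<and> r \<noteq> 0"
proof -
  have relation: "D b v = D a (D b v) - D b (D a v)" for v
    using D_star[of a b v] by (simp add: star)
  obtain p q where ba: "D b a = p \<cdot> a + q \<cdot> b" using cbasis_coords[OF ab] by blast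
  obtain r s where bb: "D b b = r \<cdot> a + s \<cdot> b" using cbasis_coords[OF ab] by blast
  obtain k m where aa: "D a a = k \<cdot> a + m \<cdot> b" using cbasis_coords[OF ab] by blast
  obtain n l where abl: "D a b = n \<cdot> a + l \<cdot> b" using cbasis_coords[OF ab] by blast
  have "p \<cdot> a + q \<cdot> b =
      (p * k + q * n - k * p - m * r) \<cdot> a + (p * m + q * l - k * q - m * s) \<cdot> b"
    using relation[of a] unfolding ba aa
    by (simp add: D_simps ba bb aa abl C_simps C.scale_left_diff_distrib algebra_simps)
  then have pq': "p = p * k + q * n - k * p - m * r" and q: "q = p * m + q * l - k * q - m * s"
    unfolding cbasis_eq[OF ab] by blast+
  from pq' have p: "p = q * n - m * r" by (simp add: mult.commute)
  have "r \<cdot> a + s \<cdot> b =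
      (r * k + s * n - n * p - l * r) \<cdot> a + (r * m + s * l - n * q - l * s) \<cdot> b"
    using relation[of b] unfolding bb abl
    by (simp add: D_simps ba bb aa abl C_simps C.scale_left_diff_distrib algebra_simps)
  then have r: "r = r * k + s * n - n * p - l * r" and s': "s = r * m + s * l - n * q - l * s"
    unfolding cbasis_eq[OF ab] by blast+
  from s' have s': "s = r * m - n * q" by (simp add: mult.commute)
  have "p + s = (q * n - m * r) + (r * m - n * q)" by (simp only: p[symmetric] s'[symmetric])
  also have "\<dots> = 0" by (simp add: algebra_simps)
  finally have s: "s = - p" by (simp add: add_eq_0_iff)
  \<comment> \<open>The trace of \<open>(D b)\<^sup>2 = D b [D a, D b]\<close> is zero, as that of \<open>T [S, T]\<close> always is.\<close>
  have "p * p + q * r + r * q + s * s =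
      p * (q * n - m * r) + q * (r * k + s * n - n * p - l * r)
      + r * (p * m + q * l - k * q - m * s) + s * (r * m - n * q)"
    by (simp only: p[symmetric] q[symmetric] r[symmetric] s'[symmetric])
  also have "\<dots> = 0" by (simp add: algebra_simps)
  finally have "2 * (p * p + q * r) = 0" by (simp add: s algebra_simps)
  then have det: "p * p + q * r = 0" by (simp only: mult_eq_0_iff) simp
  have "r \<noteq> 0"
  proof
    assume "r = 0"
    then have "p = 0" "s = 0" using det s by auto
    have \<theta>b: "\<theta> (z \<cdot> b) = 0" for z
      using \<theta>_cscale[OF ab ba bb] by (simp add: s)
    have ba': "D b a = q \<cdot> b" and bb': "D b b = 0"
      using ba bb \<open>r = 0\<close> \<open>p = 0\<close> \<open>s = 0\<close> by auto
    have "n = 0"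
    proof (cases "q = 0")
      case False
      then show ?thesis using p \<open>p = 0\<close> \<open>r = 0\<close> by simp
    next
      case True
      have "D b x = 0" for x
        using cbasis_coords[OF ab, of x] ba' bb' True by (auto simp: D_simps)
      moreover from this have "D (D a b) b = 0"
        using D_on_star[of b a b] by (simp add: star D_simps star_simps)
      ultimately have "(cnj n * n) \<cdot> a + (cnj n * l) \<cdot> b = 0"
        by (simp add: abl D_simps C_simps)
      then show ?thesis by (auto simp: cbasis_zero[OF ab])
    qed
    then show False
      using degenerate[OF cbasis_swap[OF ab] \<theta>b, of 0 q l] by (simp add: ba' bb' abl)
  qed
  define a' where "a' = a + (- p / r) \<cdot> b"
  have "cbasis a' b" unfolding a'_def by (intro cbasis_swap[OF cbasis_shear] cbasis_swap[OF ab])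
  moreover have "a' \<star> b = b" by (simp add: a'_def star_simps star)
  moreover have "D b a' = 0"
  proof -
    have "D b a' = (p + (- p / r) * r) \<cdot> a + (q + (- p / r) * s) \<cdot> b"
      by (simp add: a'_def D_simps ba bb C_simps algebra_simps)
    also have "p + (- p / r) * r = 0" using \<open>r \<noteq> 0\<close> by simp
    also have "q + (- p / r) * s = 0" using \<open>r \<noteq> 0\<close> det by (simp add: s field_simps)
    finally show ?thesis by simp
  qed
  moreover have "D b b = r \<cdot> a'"
    using \<open>r \<noteq> 0\<close> by (simp add: bb a'_def C_simps s C.scale_right_diff_distrib)
  ultimately show ?thesis using \<open>r \<noteq> 0\<close> by blast
qed

text \<open>In the adapted basis \<open>D a a = s a\<close> and \<open>D a b = t a + (s - 1) b\<close>. Compatibility gives \<open>t = 0\<close> and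
  \<open>\<bar>s\<bar>\<^sup>2 = s + cnj s\<close>, which means that \<open>s - 1\<close> lies on the unit circle, and that \<open>r cnj s\<close> is real; nondegeneracy
  excludes \<open>s = 0\<close>. Rescaling \<open>a\<close> by \<open>1 / cnj s\<close> turns \<open>D a a\<close> into \<open>a\<close>, and \<open>1 / cnj s\<close> has real part
  one half.\<close>

lemma nonabelian_normal_form:
  assumes "x \<star> y \<noteq> 0" shows "\<exists>\<rho> \<tau> a b. heisenberg_form \<rho> \<tau> a b"
proof -
  obtain a0 b where "cbasis a0 b" "a0 \<star> b = b" using nonabelian_cbasis[OF assms] by blast
  then obtain a r where ab: "cbasis a b" and star: "a \<star> b = b"
    and ba: "D b a = 0" and bb: "D b b = r \<cdot> a" and "r \<noteq> 0"
    using nonabelian_adapted_cbasis by blast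
  obtain s m where aa: "D a a = s \<cdot> a + m \<cdot> b" using cbasis_coords[OF ab] by blast
  obtain t l where abl: "D a b = t \<cdot> a + l \<cdot> b" using cbasis_coords[OF ab] by blast
  have star': "b \<star> a = - b" using star_swap[of b a] star by simp
  have "(m * r) \<cdot> a = 0"
    using D_star[of a b a] by (simp add: star ba bb aa D_simps)
  then have "m = 0" using \<open>r \<noteq> 0\<close> cbasis_nonzero[OF ab] by simp
  then have aa: "D a a = s \<cdot> a" using aa by simp
  have "(r * s - l * r - r) \<cdot> a = 0"
    using D_star[of a b b] by (simp add: star ba bb aa abl D_simps C.scale_left_diff_distrib)
  then have "r * s - l * r - r = 0" using cbasis_nonzero[OF ab] by simp
  then have "r * (s - l - 1) = 0" by (simp add: algebra_simps)
  then have "s - l - 1 = 0" using \<open>r \<noteq> 0\<close> by (simp only: mult_eq_0_iff) blast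
  then have l: "l = s - 1" by (simp add: algebra_simps)
  have "(t + cnj s * t) \<cdot> a + (cnj s * (s - 1) - s) \<cdot> b = 0"
    using D_on_star[of a a b]
    by (simp add: star star' ba bb aa abl l D_simps star_simps C_simps C.scale_left_diff_distrib algebra_simps)
  then have t: "t * (1 + cnj s) = 0" and s: "cnj s * (s - 1) = s"
    unfolding cbasis_zero[OF ab] by (auto simp: algebra_simps)
  have "(cnj r * s - cnj t * t - (cnj s - 1) * r - r) \<cdot> a + (- cnj t * (s - 1)) \<cdot> b = 0"
    using D_on_star[of b a b]
    by (simp add: star star' ba bb aa abl l D_simps star_simps C_simps C.scale_left_diff_distrib algebra_simps)
  then have r: "cnj r * s - cnj t * t - cnj s * r = 0" and ts: "cnj t * (s - 1) = 0"
    unfolding cbasis_zero[OF ab] by (auto simp: algebra_simps)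
  have "t = 0"
  proof (rule ccontr)
    assume "t \<noteq> 0"
    then have "s = 1" "1 + cnj s = 0" using t ts by auto
    then show False by simp
  qed
  have "s \<noteq> 0"
  proof
    assume "s = 0"
    have "\<theta> (z \<cdot> b) = 0" for z
      using \<theta>_cscale[OF ab, of b 0 0 r 0] by (simp add: ba bb)
    then show False
      using degenerate[OF ab, of b 0 "- 1" 0] by (simp add: aa abl ba l \<open>s = 0\<close> \<open>t = 0\<close>)
  qed
  define \<tau> where "\<tau> = - Im (1 / cnj s)"
  have ss: "cnj s * s = s + cnj s" using s by (simp add: algebra_simps)
  have "1 / s + 1 / cnj s = (s + cnj s) / (cnj s * s)"
    using \<open>s \<noteq> 0\<close> by (simp add: add_frac_eq add.commute mult.commute)
  also have "\<dots> = 1" unfolding ss[symmetric] using \<open>s \<noteq> 0\<close> by simp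
  finally have "1 / s + 1 / cnj s = 1" .
  then have "Re (1 / s) + Re (1 / cnj s) = 1" by (metis plus_complex.simps(1) one_complex.simps(1))
  moreover have "Re (1 / s) = Re (1 / cnj s)"
    by (metis complex_cnj_divide complex_cnj_one complex_cnj_cnj cnj.simps(1))
  ultimately have \<tau>: "1 / cnj s = Complex (1/2) (- \<tau>)"
    by (intro complex_eqI) (auto simp: \<tau>_def)
  have \<tau>': "(s - 1) / s = Complex (1/2) (- \<tau>)"
    unfolding \<tau>[symmetric] using \<open>s \<noteq> 0\<close> s by (simp add: field_simps)
  define \<rho> where "\<rho> = Re (r * cnj s)"
  have "cnj (r * cnj s) = r * cnj s" using r \<open>t = 0\<close> by (simp add: mult.commute)
  then have \<rho>: "r * cnj s = of_real \<rho>"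
    by (metis \<rho>_def Reals_cnj_iff of_real_Re)
  have "heisenberg_form \<rho> \<tau> ((1 / cnj s) \<cdot> a) b"
    unfolding heisenberg_form_def
  proof (intro conjI)
    show "cbasis ((1 / cnj s) \<cdot> a) b" using cbasis_scale[OF ab, of "1 / cnj s" 1] \<open>s \<noteq> 0\<close> by simp
    show "((1 / cnj s) \<cdot> a) \<star> b = Complex (1/2) (- \<tau>) \<cdot> b"
      by (simp add: star_simps star \<tau>)
    show "\<rho> \<noteq> 0" using \<rho> \<open>r \<noteq> 0\<close> \<open>s \<noteq> 0\<close> by auto
    show "D ((1 / cnj s) \<cdot> a) ((1 / cnj s) \<cdot> a) = (1 / cnj s) \<cdot> a"
      using \<open>s \<noteq> 0\<close> by (simp add: D_simps aa)
    show "D ((1 / cnj s) \<cdot> a) b = Complex (1/2) (- \<tau>) \<cdot> b"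
      using \<open>s \<noteq> 0\<close> by (simp add: D_simps abl \<open>t = 0\<close> l \<tau>'[symmetric])
    show "D b ((1 / cnj s) \<cdot> a) = 0" by (simp add: D_simps ba)
    show "D b b = \<rho> *\<^sub>R (1 / cnj s) \<cdot> a"
      using \<open>s \<noteq> 0\<close> by (simp add: bb of_real_cscale[symmetric] \<rho>[symmetric])
  qed
  then show ?thesis by blast
qed

end

section \<open>Recognising the models\<close>

definition frame :: "'a::real_vector \<Rightarrow> 'a \<Rightarrow> 'a \<Rightarrow> 'a \<Rightarrow> real^4 \<Rightarrow> 'a" where
  "frame v1 v2 v3 v4 x = x $ 1 *\<^sub>R v1 + x $ 2 *\<^sub>R v2 + x $ 3 *\<^sub>R v3 + x $ 4 *\<^sub>R v4"

lemma linear_frame: "linear (frame v1 v2 v3 v4)"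
  by (rule linearI) (simp_all add: frame_def algebra_simps)

lemma frame_e:
  "frame v1 v2 v3 v4 (e 1) = v1" "frame v1 v2 v3 v4 (e 2) = v2"
  "frame v1 v2 v3 v4 (e 3) = v3" "frame v1 v2 v3 v4 (e 4) = v4"
  by (simp_all add: frame_def axis_def)

lemmas frame_simps = linear_add[OF linear_frame] linear_diff[OF linear_frame]
  linear_cmul[OF linear_frame] linear_neg[OF linear_frame] frame_e

lemma ex_real_4: "\<exists>x::real^4. x $ 1 = c1 \<and> x $ 2 = c2 \<and> x $ 3 = c3 \<and> x $ 4 = c4"
  by (rule exI[of _ "frame (c1 *\<^sub>R e 1) (c2 *\<^sub>R e 2) (c3 *\<^sub>R e 3) (c4 *\<^sub>R e 4) 1"])
    (simp add: frame_def axis_def)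

text \<open>The equivalence is the inverse of the frame, so that all conditions are checked on \<open>\<real>\<^sup>4\<close>.\<close>

lemma frame_equivalent:
  assumes bij: "bij (frame v1 v2 v3 v4)"
    and br: "\<And>x y. frame v1 v2 v3 v4 (br' x y) = br (frame v1 v2 v3 v4 x) (frame v1 v2 v3 v4 y)"
    and J: "\<And>x. frame v1 v2 v3 v4 (J' x) = J (frame v1 v2 v3 v4 x)"
    and g: "\<And>x y. g' x y = g (frame v1 v2 v3 v4 x) (frame v1 v2 v3 v4 y)"
  shows "equivalent_to br J g br' J' g'"
proof -
  let ?F = "frame v1 v2 v3 v4"
  let ?\<phi> = "inv ?F"
  have F\<phi>: "?F (?\<phi> x) = x" for x using bij by (simp add: bij_is_surj surj_f_inv_f)
  have eqI: "x = y" if "?F x = ?F y" for x y using bij that by (simp add: bij_is_inj inj_eq)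
  have "linear ?\<phi>"
    by (rule linearI; rule eqI) (simp_all add: frame_simps F\<phi>)
  moreover have "bij ?\<phi>" using bij by (rule bij_imp_bij_inv)
  moreover have "?\<phi> (br x y) = br' (?\<phi> x) (?\<phi> y)" for x y
    by (rule eqI) (simp add: br F\<phi>)
  moreover have "?\<phi> (J x) = J' (?\<phi> x)" for x
    by (rule eqI) (simp add: J F\<phi>)
  moreover have "g x y = g' (?\<phi> x) (?\<phi> y)" for x y
    by (simp add: g F\<phi>)
  ultimately show ?thesis unfolding equivalent_to_def by blast
qed

lemma (in lie_algebra) br_frame:
  "br (frame v1 v2 v3 v4 x) (frame v1 v2 v3 v4 y) =
     wedge 1 2 x y *\<^sub>R br v1 v2 + wedge 1 3 x y *\<^sub>R br v1 v3 + wedge 1 4 x y *\<^sub>R br v1 v4 +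
     wedge 2 3 x y *\<^sub>R br v2 v3 + wedge 2 4 x y *\<^sub>R br v2 v4 + wedge 3 4 x y *\<^sub>R br v3 v4"
  by (simp add: frame_def wedge_def br_simps alternating_br br_swap[of v1 v2] br_swap[of v1 v3]
      br_swap[of v1 v4] br_swap[of v2 v3] br_swap[of v2 v4] br_swap[of v3 v4] algebra_simps)

lemma (in lie_algebra) br_flip: "br x y = z \<Longrightarrow> br y x = - z"
  using br_swap by blast

lemma wedge_swap: "wedge j i x y = - wedge i j x y"
  by (simp add: wedge_def)

context koszul_surface begin

definition metric :: "'a \<Rightarrow> 'a \<Rightarrow> real" where
  "metric x y = \<theta> (br (J x) y)"

lemma metric_simps:
  "metric (x + y) z = metric x z + metric y z" "metric x (y + z) = metric x y + metric x z"
  "metric (r *\<^sub>R x) z = r * metric x z" "metric x (r *\<^sub>R z) = r * metric x z"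
  by (simp_all add: metric_def J_simps br_simps \<theta>_simps)

lemma metric_swap: "metric y x = metric x y"
  using br_swap[of x "J y"] J_invariant_\<theta>[of x "J y"]
  by (simp add: metric_def J_simps br_simps \<theta>_simps)

lemma metric_frame:
  assumes "metric v1 v2 = 0" "metric v1 v3 = 0" "metric v1 v4 = 0"
    "metric v2 v3 = 0" "metric v2 v4 = 0" "metric v3 v4 = 0"
  shows "metric (frame v1 v2 v3 v4 x) (frame v1 v2 v3 v4 y) =
    metric v1 v1 * sq 1 x y + metric v2 v2 * sq 2 x y + metric v3 v3 * sq 3 x y + metric v4 v4 * sq 4 x y"
  using assms metric_swap[of v1 v2] metric_swap[of v1 v3] metric_swap[of v1 v4]
    metric_swap[of v2 v3] metric_swap[of v2 v4] metric_swap[of v3 v4]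
  by (simp add: frame_def sq_def metric_simps)

lemma br_half: "br x y = (1/2) *\<^sub>R (x \<star> y + D x y - D y x)"
  unfolding two_br[symmetric] by simp

lemma bij_frame:
  assumes ab: "cbasis a b"
    and frame: "\<And>x. frame v1 v2 v3 v4 x = Z x \<cdot> a + W x \<cdot> b"
    and inj: "\<And>x. Z x = 0 \<Longrightarrow> W x = 0 \<Longrightarrow> x = 0"
    and surj: "\<And>z w. \<exists>x. Z x = z \<and> W x = w"
  shows "bij (frame v1 v2 v3 v4)"
proof (rule bijI)
  show "inj (frame v1 v2 v3 v4)"
    unfolding linear_injective_0[OF linear_frame] frame using inj cbasis_zero[OF ab] by blast
  show "surj (frame v1 v2 v3 v4)"
    unfolding surj_def
  proof
    fix v
    obtain z w where "v = z \<cdot> a + w \<cdot> b" using cbasis_coords[OF ab] by blast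
    moreover obtain x where "Z x = z" "W x = w" using surj by blast
    ultimately show "\<exists>x. v = frame v1 v2 v3 v4 x" by (auto simp: frame)
  qed
qed

lemma diagonal_equivalent:
  assumes "diagonal_form a b"
  shows "equivalent_to br J metric affR_affR affR_affR_J
    (\<lambda>x y. \<kappa> * (sq 1 x y + sq 2 x y + sq 3 x y + sq 4 x y))"
proof (rule frame_equivalent)
  have ab: "cbasis a b" and form: "a \<star> b = 0" "D a a = a" "D b b = b" "D a b = 0" "D b a = 0"
    using assms by (auto simp: diagonal_form_def)
  let ?F = "frame a (J a) b (J b)"
  have br: "br a (J a) = J a" "br a b = 0" "br a (J b) = 0" "br (J a) b = 0"
    "br (J a) (J b) = 0" "br b (J b) = J b"
    by (simp_all add: br_half star_J star_simps D_J form J_simps alternating_br scaleR_2[symmetric])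
  have \<theta>: "\<theta> (J a) = - \<kappa>" "\<theta> (J b) = - \<kappa>"
    using \<theta>_cscale[OF ab, of a 1 0 0 0 \<i>] \<theta>_cscale[OF ab, of b 0 0 0 1 \<i>]
    by (simp_all add: form i_cscale)
  show "bij ?F"
  proof (rule bij_frame[OF ab])
    show "?F x = Complex (x $ 1) (x $ 2) \<cdot> a + Complex (x $ 3) (x $ 4) \<cdot> b" for x
      by (simp add: frame_def cscale_def)
    show "x = 0" if "Complex (x $ 1) (x $ 2) = 0" "Complex (x $ 3) (x $ 4) = 0" for x :: "real^4"
      using that by (simp add: vec_eq_iff forall_4 complex_eq_iff)
    show "\<exists>x::real^4. Complex (x $ 1) (x $ 2) = z \<and> Complex (x $ 3) (x $ 4) = w" for z w
      using ex_real_4[of "Re z" "Im z" "Re w" "Im w"] by (auto simp: complex_eq_iff)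
  qed
  show "?F (affR_affR x y) = br (?F x) (?F y)" for x y
    unfolding br_frame affR_affR_def by (simp add: frame_simps br)
  show "?F (affR_affR_J x) = J (?F x)" for x
    unfolding affR_affR_J_def rot_def by (simp add: frame_simps) (simp add: frame_def J_simps)
  note br' = br[THEN br_flip]
  show "\<kappa> * (sq 1 x y + sq 2 x y + sq 3 x y + sq 4 x y) = metric (?F x) (?F y)" for x y
    by (subst metric_frame)
      (simp_all add: metric_def br br' J_simps br_simps \<theta>_simps \<theta> alternating_br algebra_simps)
qed

text \<open>The vector \<open>a + b\<close> is a unit, as \<open>D (a + b)\<close> is the identity. Its companion \<open>e\<^sub>2\<close> has to satisfy
  \<open>D e\<^sub>2 e\<^sub>2 = - (a + b)\<close> and \<open>D e\<^sub>2 (a + b) = e\<^sub>2\<close>, which determines it up to sign as \<open>J b - J a\<close>.\<close>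

lemma crossed_equivalent:
  assumes "crossed_form a b"
  shows "equivalent_to br J metric affC affC_J1
    (\<lambda>x y. (2 * \<kappa>) * (sq 1 x y - sq 2 x y + sq 3 x y - sq 4 x y))"
proof (rule frame_equivalent)
  have ab: "cbasis a b" and form: "a \<star> b = 0" "D a a = 0" "D b b = 0" "D a b = b" "D b a = a"
    using assms by (auto simp: crossed_form_def)
  have form': "b \<star> a = 0" using star_swap[of b a] form by simp
  let ?F = "frame (a + b) (J b - J a) (J a + J b) (a - b)"
  have br: "br a b = (1/2) *\<^sub>R (b - a)" "br (J a) (J b) = (1/2) *\<^sub>R (b - a)"
    "br a (J b) = (1/2) *\<^sub>R (J a + J b)" "br b (J a) = (1/2) *\<^sub>R (J a + J b)"
    "br a (J a) = 0" "br b (J b) = 0"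
    by (simp_all add: br_half star_J star_simps D_J form form' J_simps alternating_br add.commute)
  note br' = br[THEN br_flip]
  have \<theta>: "\<theta> (J a) = - \<kappa>" "\<theta> (J b) = - \<kappa>" "\<theta> a = 0" "\<theta> b = 0"
    using \<theta>_cscale[OF ab, of a 0 0 0 1 \<i>] \<theta>_cscale[OF ab, of b 1 0 0 0 \<i>]
      \<theta>_cscale[OF ab, of a 0 0 0 1 1] \<theta>_cscale[OF ab, of b 1 0 0 0 1]
    by (simp_all add: form i_cscale)
  show "bij ?F"
  proof (rule bij_frame[OF ab])
    show "?F x = Complex (x $ 1 + x $ 4) (x $ 3 - x $ 2) \<cdot> a + Complex (x $ 1 - x $ 4) (x $ 3 + x $ 2) \<cdot> b" for x
      by (simp add: frame_def cscale_def algebra_simps)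
    show "x = 0" if "Complex (x $ 1 + x $ 4) (x $ 3 - x $ 2) = 0" "Complex (x $ 1 - x $ 4) (x $ 3 + x $ 2) = 0"
      for x :: "real^4"
      using that by (simp add: vec_eq_iff forall_4 complex_eq_iff)
    show "\<exists>x::real^4. Complex (x $ 1 + x $ 4) (x $ 3 - x $ 2) = z \<and> Complex (x $ 1 - x $ 4) (x $ 3 + x $ 2) = w" for z w
    proof -
      obtain x :: "real^4" where "x $ 1 = (Re z + Re w) / 2" "x $ 2 = (Im w - Im z) / 2"
        "x $ 3 = (Im w + Im z) / 2" "x $ 4 = (Re z - Re w) / 2" using ex_real_4 by blast
      then show ?thesis by (intro exI[of _ x]) (simp add: complex_eq_iff field_simps)
    qed
  qed
  show "?F (affC x y) = br (?F x) (?F y)" for x y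
    unfolding br_frame affC_def
    by (simp add: frame_simps br br' br_simps alternating_br algebra_simps scaleR_2[symmetric])
  show "?F (affC_J1 x) = J (?F x)" for x
    unfolding affC_J1_def rot_def by (simp add: frame_simps) (simp add: frame_def J_simps algebra_simps)
  show "(2 * \<kappa>) * (sq 1 x y - sq 2 x y + sq 3 x y - sq 4 x y) = metric (?F x) (?F y)" for x y
    by (subst metric_frame)
      (simp_all add: metric_def br br' J_simps br_simps \<theta>_simps \<theta> alternating_br algebra_simps)
qed

text \<open>One frame serves all remaining models. The sign \<open>s\<close> is that of \<open>J e\<^sub>1 = s e\<^sub>2\<close>, and \<open>s'\<close> that of
  \<open>J e\<^sub>4 = s' e\<^sub>3\<close>; the length \<open>k\<close> of \<open>e\<^sub>1\<close> is fixed by \<open>[e\<^sub>1, e\<^sub>2] = e\<^sub>3\<close>, and \<open>d\<close> by the size that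
  the rotation part of \<open>ad e\<^sub>4\<close> is to have.\<close>

lemma heisenberg_equivalent:
  assumes "heisenberg_form \<rho> \<tau> a b"
    and "d > 0" "k > 0" and s: "s * s = 1" "s' * s' = 1" and k: "k * k * \<rho> * s = s' * d"
  shows "equivalent_to br J metric
    (\<lambda>x y. wedge 1 2 x y *\<^sub>R e 3 + wedge 4 3 x y *\<^sub>R d *\<^sub>R e 3
      + wedge 4 1 x y *\<^sub>R ((d/2) *\<^sub>R e 1 - (d * \<tau> * s) *\<^sub>R e 2)
      + wedge 4 2 x y *\<^sub>R ((d * \<tau> * s) *\<^sub>R e 1 + (d/2) *\<^sub>R e 2))
    (\<lambda>x. s *\<^sub>R rot 1 2 x + s' *\<^sub>R rot 4 3 x)
    (\<lambda>x y. (3/2 * \<kappa> * d) * (s * s' * (sq 1 x y + sq 2 x y) + d * (sq 3 x y + sq 4 x y)))"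
proof (rule frame_equivalent)
  have ab: "cbasis a b" and "\<rho> \<noteq> 0"
    and form: "a \<star> b = Complex (1/2) (- \<tau>) \<cdot> b" "D a a = a" "D a b = Complex (1/2) (- \<tau>) \<cdot> b"
      "D b a = 0" "D b b = \<rho> *\<^sub>R a"
    using assms by (auto simp: heisenberg_form_def)
  let ?F = "frame (k *\<^sub>R b) ((s * k) *\<^sub>R J b) ((s' * d) *\<^sub>R J a) (d *\<^sub>R a)"
  have br: "br a (J a) = J a" "br a b = (1/2) *\<^sub>R b - \<tau> *\<^sub>R J b" "br a (J b) = (1/2) *\<^sub>R J b + \<tau> *\<^sub>R b"
    "br (J a) b = 0" "br (J a) (J b) = 0" "br b (J b) = \<rho> *\<^sub>R J a"
    by (simp_all add: br_half star_J star_simps D_J form J_simps alternating_br cscale_def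
        scaleR_2[symmetric] algebra_simps)
  note br' = br[THEN br_flip]
  have \<theta>: "\<theta> (J a) = - (3/2 * \<kappa>)" "\<theta> b = 0" "\<theta> (J b) = 0"
    using \<theta>_cscale[OF ab, of a 1 0 0 "Complex (1/2) (- \<tau>)" \<i>]
      \<theta>_cscale[OF ab, of b 0 0 "of_real \<rho>" 0 1] \<theta>_cscale[OF ab, of b 0 0 "of_real \<rho>" 0 \<i>]
    by (simp_all add: form i_cscale of_real_cscale)
  have nz: "s \<noteq> 0" "s' \<noteq> 0" using s by auto
  show "bij ?F"
  proof (rule bij_frame[OF ab])
    show "?F x = Complex (d * x $ 4) (s' * d * x $ 3) \<cdot> a + Complex (k * x $ 1) (s * k * x $ 2) \<cdot> b" for x
      by (simp add: frame_def cscale_def algebra_simps)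
    show "x = 0" if "Complex (d * x $ 4) (s' * d * x $ 3) = 0" "Complex (k * x $ 1) (s * k * x $ 2) = 0"
      for x :: "real^4"
      using that nz \<open>d > 0\<close> \<open>k > 0\<close> by (simp add: vec_eq_iff forall_4 complex_eq_iff)
    show "\<exists>x::real^4. Complex (d * x $ 4) (s' * d * x $ 3) = z \<and> Complex (k * x $ 1) (s * k * x $ 2) = w" for z w
    proof -
      obtain x :: "real^4" where "x $ 1 = Re w / k" "x $ 2 = Im w / (s * k)"
        "x $ 3 = Im z / (s' * d)" "x $ 4 = Re z / d" using ex_real_4 by blast
      then show ?thesis using nz \<open>d > 0\<close> \<open>k > 0\<close>
        by (intro exI[of _ x]) (simp add: complex_eq_iff)
    qed
  qed
  have k': "\<rho> * (k * (k * s)) = s' * d" "s * (k * (k * \<rho>)) = s' * d" "k * (s * (k * \<rho>)) = s' * d"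
    "k * (k * \<rho>) = s * s' * d"
  proof -
    show "k * (k * \<rho>) = s * s' * d"
      using k s by (metis mult.assoc mult.commute mult.right_neutral)
  qed (use k in \<open>simp_all add: mult_ac\<close>)
  have k'': "\<rho> * (k * (k * r)) = d * (s * (s' * r))" for r
  proof -
    have "\<rho> * (k * (k * r)) = (k * (k * \<rho>)) * r" by (simp add: mult_ac)
    then show ?thesis unfolding k' by (simp add: mult_ac)
  qed
  have ss: "s * (s * r) = r" "s' * (s' * r) = r" for r
    using s by (simp_all flip: mult.assoc)
  show "?F (wedge 1 2 x y *\<^sub>R e 3 + wedge 4 3 x y *\<^sub>R d *\<^sub>R e 3
      + wedge 4 1 x y *\<^sub>R ((d/2) *\<^sub>R e 1 - (d * \<tau> * s) *\<^sub>R e 2)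
      + wedge 4 2 x y *\<^sub>R ((d * \<tau> * s) *\<^sub>R e 1 + (d/2) *\<^sub>R e 2)) = br (?F x) (?F y)" for x y
    unfolding br_frame wedge_swap[of 4 3] wedge_swap[of 4 1] wedge_swap[of 4 2]
    by (simp add: frame_simps br br' br_simps ss k k' algebra_simps mult_ac)
  show "?F (s *\<^sub>R rot 1 2 x + s' *\<^sub>R rot 4 3 x) = J (?F x)" for x
    unfolding rot_def by (simp add: frame_simps) (simp add: frame_def J_simps ss algebra_simps)
  show "(3/2 * \<kappa> * d) * (s * s' * (sq 1 x y + sq 2 x y) + d * (sq 3 x y + sq 4 x y)) = metric (?F x) (?F y)" for x y
    by (subst metric_frame)
      (simp_all add: metric_def br br' J_simps br_simps \<theta>_simps \<theta> alternating_br ss k k' k'' algebra_simps)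
qed

end

section \<open>The classification\<close>

lemma (in complex_lie_algebra) D_scaleR: "D (r *\<^sub>R x) y = r *\<^sub>R D x y"
  by (simp add: D_def J_simps br_simps algebra_simps)

context finite_kaehler_lie_algebra begin

lemma linear_koszul_form: "linear koszul_form"
  by (rule linearI)
    (simp_all add: koszul_form_def D_simps D_scaleR J_simps trace_add trace_scale)

text \<open>The real trace of a complex linear operator is twice the real part of the complex trace; here the
  operator is multiplied by \<open>J\<close>, that is by \<open>\<i>\<close>.\<close>

lemma koszul_form_complex_trace:
  assumes ab: "cbasis a b" and "D x a = p \<cdot> a + q \<cdot> b" "D x b = r \<cdot> a + s \<cdot> b"
  shows "koszul_form x = - 2 * Im (p + s)"
proof -
  obtain Z W where ZW: "\<And>v. v = Z v \<cdot> a + W v \<cdot> b"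
    using cbasis_coords[OF ab] by metis
  have uniq: "Z v = z \<and> W v = w" if "v = z \<cdot> a + w \<cdot> b" for v z w
    using cbasis_eq[OF ab] ZW[of v] that by metis
  have "Z (u + v) = Z u + Z v \<and> W (u + v) = W u + W v" for u v
    by (rule uniq, subst (1) ZW[of u], subst (1) ZW[of v]) (simp add: C.scale_left_distrib algebra_simps)
  moreover have "Z (t *\<^sub>R u) = of_real t * Z u \<and> W (t *\<^sub>R u) = of_real t * W u" for t u
    by (rule uniq, subst (1) ZW[of u]) (simp add: of_real_cscale[symmetric] C.scale_right_distrib)
  ultimately have lin: "linear (\<lambda>v. Re (Z v))" "linear (\<lambda>v. Im (Z v))" "linear (\<lambda>v. Re (W v))"
    "linear (\<lambda>v. Im (W v))"
    by (auto intro!: linearI)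
  have linJD: "linear (\<lambda>v. J (D x v))"
    using linear_compose[OF linear_D linear_J] by (simp add: o_def)
  define f where "f = (\<lambda>i::nat. [a, J a, b, J b] ! i)"
  define c where "c = (\<lambda>(i::nat) v. [Re (Z v), Im (Z v), Re (W v), Im (W v)] ! i)"
  have "trace (\<lambda>v. J (D x v)) = (\<Sum>i<4. c i (J (D x (f i))))"
  proof (rule trace_coordinates[OF linJD])
    show "linear (c i)" if "i \<in> {..<4}" for i
      using that lin by (auto simp: c_def less_Suc_eq numeral_eq_Suc)
    have "v = c 0 v *\<^sub>R f 0 + c 1 v *\<^sub>R f 1 + c 2 v *\<^sub>R f 2 + c 3 v *\<^sub>R f 3" for v
      by (subst ZW[of v]) (simp add: c_def f_def cscale_def numeral_eq_Suc)
    then show "v = (\<Sum>i<4. c i v *\<^sub>R f i)" for v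
      by (simp add: numeral_eq_Suc)
  qed
  also have "\<dots> = Re (Z (J (D x a))) + Im (Z (J (D x (J a)))) + Re (W (J (D x b))) + Im (W (J (D x (J b))))"
    by (simp add: numeral_eq_Suc c_def f_def)
  also have "\<dots> = - 2 * Im (p + s)"
  proof -
    have "Z (J (D x a)) = \<i> * p" "Z (J (D x (J a))) = - p" "W (J (D x b)) = \<i> * s" "W (J (D x (J b))) = - s"
      using uniq[of "J (D x a)" "\<i> * p" "\<i> * q"] uniq[of "J (D x (J a))" "- p" "- q"]
        uniq[of "J (D x b)" "\<i> * r" "\<i> * s"] uniq[of "J (D x (J b))" "- r" "- s"]
      by (simp_all add: D_J J_simps assms(2,3) J_cscale)
    then show ?thesis by simp
  qed
  finally show ?thesis by (simp add: koszul_form_def)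
qed

end

context koszul_surface begin

text \<open>Take \<open>s\<close> to be the sign of \<open>\<tau>\<close>, or, when \<open>\<tau> = 0\<close>, the sign of \<open>\<rho>\<close>, which makes \<open>J e\<^sub>4 = e\<^sub>3\<close>. The other
  sign is then \<open>s' = s sgn \<rho>\<close>, so \<open>s s' = sgn \<rho>\<close> is the relative sign of the metric on the two complex
  lines.\<close>

lemma heisenberg_model:
  assumes "heisenberg_form \<rho> \<tau> a b"
  shows "\<exists>\<alpha>. \<alpha> \<noteq> 0 \<and>
     (equivalent_to br J metric d4_half d4_half_J1
       (\<lambda>x y. \<alpha> * (sq 1 x y + sq 2 x y + sq 3 x y + sq 4 x y))
   \<or> equivalent_to br J metric d4_half d4_half_J2
       (\<lambda>x y. \<alpha> * (sq 1 x y + sq 2 x y - sq 3 x y - sq 4 x y))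
   \<or> (\<exists>\<delta>>0. \<exists>J'\<in>{d4'_J1, d4'_J3}. equivalent_to br J metric (d4' \<delta>) J'
       (\<lambda>x y. \<alpha> * (sq 1 x y + sq 2 x y + \<delta> * (sq 3 x y + sq 4 x y))))
   \<or> (\<exists>\<delta>>0. \<exists>J'\<in>{d4'_J2, d4'_J4}. equivalent_to br J metric (d4' \<delta>) J'
       (\<lambda>x y. \<alpha> * (sq 1 x y + sq 2 x y - \<delta> * (sq 3 x y + sq 4 x y)))))"
proof -
  have "\<rho> \<noteq> 0" using assms by (simp add: heisenberg_form_def)
  define d where "d = (if \<tau> = 0 then 1 else 1 / \<bar>\<tau>\<bar>)"
  define k where "k = sqrt (d / \<bar>\<rho>\<bar>)"
  have "d > 0" by (simp add: d_def)
  have "k > 0" using \<open>d > 0\<close> \<open>\<rho> \<noteq> 0\<close> by (simp add: k_def)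
  have "k * k = d / \<bar>\<rho>\<bar>" using \<open>d > 0\<close> by (simp add: k_def)
  then have k: "k * k * \<rho> = sgn \<rho> * d" using \<open>\<rho> \<noteq> 0\<close> by (simp add: sgn_real_def abs_if)
  let ?br = "\<lambda>s x y. wedge 1 2 x y *\<^sub>R e 3 + wedge 4 3 x y *\<^sub>R d *\<^sub>R e 3
      + wedge 4 1 x y *\<^sub>R ((d/2) *\<^sub>R e 1 - (d * \<tau> * s) *\<^sub>R e 2)
      + wedge 4 2 x y *\<^sub>R ((d * \<tau> * s) *\<^sub>R e 1 + (d/2) *\<^sub>R e 2)"
  let ?J = "\<lambda>s s' x. s *\<^sub>R rot 1 2 x + s' *\<^sub>R rot 4 3 x"
  let ?g = "\<lambda>s s' x y. (3/2 * \<kappa> * d) * (s * s' * (sq 1 x y + sq 2 x y) + d * (sq 3 x y + sq 4 x y))"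
  have equiv: "equivalent_to br J metric (?br s) (?J s (s * sgn \<rho>)) (?g s (s * sgn \<rho>))"
    if "s = 1 \<or> s = - 1" for s
    by (rule heisenberg_equivalent[OF assms \<open>d > 0\<close> \<open>k > 0\<close>])
      (use that k \<open>\<rho> \<noteq> 0\<close> in \<open>auto simp: sgn_real_def split: if_splits\<close>)
  have \<kappa>: "3/2 * \<kappa> * d \<noteq> 0" "- (3/2 * \<kappa> * d) \<noteq> 0" using \<kappa>_nonzero \<open>d > 0\<close> by auto
  show ?thesis
  proof (cases "\<tau> = 0")
    case True
    then have "d = 1" by (simp add: d_def)
    then have br: "?br s = d4_half" for s
      using True by (auto simp: d4_half_def fun_eq_iff)
    show ?thesis
    proof (cases "\<rho> > 0")
      case True
      have "?J 1 (1 * sgn \<rho>) = d4_half_J1" using True by (auto simp: d4_half_J1_def fun_eq_iff)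
      moreover have "?g 1 (1 * sgn \<rho>) = (\<lambda>x y. (3/2 * \<kappa> * d) * (sq 1 x y + sq 2 x y + sq 3 x y + sq 4 x y))"
        using True \<open>d = 1\<close> by (auto simp: fun_eq_iff)
      ultimately have "equivalent_to br J metric d4_half d4_half_J1
          (\<lambda>x y. (3/2 * \<kappa> * d) * (sq 1 x y + sq 2 x y + sq 3 x y + sq 4 x y))"
        using equiv[of 1] unfolding br by (simp only: simp_thms)
      then show ?thesis
        by (intro exI[of _ "3/2 * \<kappa> * d"] conjI \<kappa>(1) disjI1)
    next
      case False
      then have "\<rho> < 0" using \<open>\<rho> \<noteq> 0\<close> by simp
      have "?J (- 1) (- 1 * sgn \<rho>) = d4_half_J2" using \<open>\<rho> < 0\<close> by (auto simp: d4_half_J2_def fun_eq_iff)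
      moreover have "?g (- 1) (- 1 * sgn \<rho>) = (\<lambda>x y. (- (3/2 * \<kappa> * d)) * (sq 1 x y + sq 2 x y - sq 3 x y - sq 4 x y))"
        using \<open>\<rho> < 0\<close> \<open>d = 1\<close> by (auto simp: fun_eq_iff algebra_simps)
      ultimately have "equivalent_to br J metric d4_half d4_half_J2
          (\<lambda>x y. (- (3/2 * \<kappa> * d)) * (sq 1 x y + sq 2 x y - sq 3 x y - sq 4 x y))"
        using equiv[of "- 1"] unfolding br by (simp only: simp_thms)
      then show ?thesis
        by (intro exI[of _ "- (3/2 * \<kappa> * d)"] conjI \<kappa>(2)) (rule disjI2, rule disjI1)
    qed
  next
    case False
    then have "d * \<tau> * sgn \<tau> = 1" by (simp add: d_def sgn_real_def)
    then have br: "?br (sgn \<tau>) = d4' d"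
      by (auto simp: d4'_def fun_eq_iff)
    have sgn: "sgn \<tau> = 1 \<or> sgn \<tau> = - 1" using False by (simp add: sgn_real_def)
    show ?thesis
    proof (cases "\<rho> > 0")
      case True
      have "?J (sgn \<tau>) (sgn \<tau> * sgn \<rho>) \<in> {d4'_J1, d4'_J3}"
        using sgn True by (auto simp: d4'_J1_def d4'_J3_def fun_eq_iff)
      moreover have "?g (sgn \<tau>) (sgn \<tau> * sgn \<rho>) =
          (\<lambda>x y. (3/2 * \<kappa> * d) * (sq 1 x y + sq 2 x y + d * (sq 3 x y + sq 4 x y)))"
        using True sgn by (auto simp: fun_eq_iff)
      ultimately have "\<exists>\<delta>>0. \<exists>J'\<in>{d4'_J1, d4'_J3}. equivalent_to br J metric (d4' \<delta>) J'
          (\<lambda>x y. (3/2 * \<kappa> * d) * (sq 1 x y + sq 2 x y + \<delta> * (sq 3 x y + sq 4 x y)))"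
        using equiv[OF sgn] \<open>d > 0\<close> unfolding br by (intro exI[of _ d] conjI) auto
      then show ?thesis
        by (intro exI[of _ "3/2 * \<kappa> * d"] conjI \<kappa>(1)) (rule disjI2, rule disjI2, rule disjI1)
    next
      case False
      then have "\<rho> < 0" using \<open>\<rho> \<noteq> 0\<close> by simp
      have "?J (sgn \<tau>) (sgn \<tau> * sgn \<rho>) \<in> {d4'_J2, d4'_J4}"
        using sgn \<open>\<rho> < 0\<close> by (auto simp: d4'_J2_def d4'_J4_def fun_eq_iff)
      moreover have "?g (sgn \<tau>) (sgn \<tau> * sgn \<rho>) =
          (\<lambda>x y. (- (3/2 * \<kappa> * d)) * (sq 1 x y + sq 2 x y - d * (sq 3 x y + sq 4 x y)))"
        using \<open>\<rho> < 0\<close> sgn by (auto simp: fun_eq_iff algebra_simps)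
      ultimately have "\<exists>\<delta>>0. \<exists>J'\<in>{d4'_J2, d4'_J4}. equivalent_to br J metric (d4' \<delta>) J'
          (\<lambda>x y. (- (3/2 * \<kappa> * d)) * (sq 1 x y + sq 2 x y - \<delta> * (sq 3 x y + sq 4 x y)))"
        using equiv[OF sgn] \<open>d > 0\<close> unfolding br by (intro exI[of _ d] conjI) auto
      then show ?thesis
        by (intro exI[of _ "- (3/2 * \<kappa> * d)"] conjI \<kappa>(2)) (rule disjI2, rule disjI2, rule disjI2)
    qed
  qed
qed

end

theorem proposition4p8:
  fixes br :: "'a::real_vector \<Rightarrow> 'a \<Rightarrow> 'a"
    and J :: "'a \<Rightarrow> 'a"
    and \<omega> g :: "'a \<Rightarrow> 'a \<Rightarrow> real"
  assumes "dim (UNIV :: 'a set) = 4"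
    and "kaehler_lie_algebra br J \<omega>"
    and "g = kaehler_metric J \<omega>"
    and "einstein br g"
    and "\<not> ricci_flat br g"
  shows "\<exists>\<alpha>::real. \<alpha> \<noteq> 0 \<and>
    (equivalent_to br J g affR_affR affR_affR_J
       (\<lambda>x y. \<alpha> * (sq 1 x y + sq 2 x y + sq 3 x y + sq 4 x y))
   \<or> equivalent_to br J g affC affC_J1
       (\<lambda>x y. \<alpha> * (sq 1 x y - sq 2 x y + sq 3 x y - sq 4 x y))
   \<or> equivalent_to br J g d4_half d4_half_J1
       (\<lambda>x y. \<alpha> * (sq 1 x y + sq 2 x y + sq 3 x y + sq 4 x y))
   \<or> equivalent_to br J g d4_half d4_half_J2
       (\<lambda>x y. \<alpha> * (sq 1 x y + sq 2 x y - sq 3 x y - sq 4 x y))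
   \<or> (\<exists>\<delta>>0. \<exists>J'\<in>{d4'_J1, d4'_J3}. equivalent_to br J g (d4' \<delta>) J'
       (\<lambda>x y. \<alpha> * (sq 1 x y + sq 2 x y + \<delta> * (sq 3 x y + sq 4 x y))))
   \<or> (\<exists>\<delta>>0. \<exists>J'\<in>{d4'_J2, d4'_J4}. equivalent_to br J g (d4' \<delta>) J'
       (\<lambda>x y. \<alpha> * (sq 1 x y + sq 2 x y - \<delta> * (sq 3 x y + sq 4 x y)))))"
proof -
  interpret K: kaehler_lie_algebra br J \<omega> by (rule assms(2))
  obtain S :: "'a set" where S: "UNIV \<subseteq> span S" "card S = 4"
    using basis_exists[of "UNIV :: 'a set"] assms(1) by metis
  then have "finite S" by (metis card.infinite zero_neq_numeral)
  with S interpret K: finite_kaehler_lie_algebra br J \<omega>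
    by unfold_locales blast
  obtain c where c: "\<And>x y. \<omega> x y = c * K.koszul_form (br x y)"
    using K.einstein_exact assms(3-5) by blast
  define \<theta> where "\<theta> x = c * K.koszul_form x" for x
  interpret koszul_surface br J \<theta> "- 2 * c"
  proof (intro koszul_surface.intro koszul_surface_axioms.intro complex_lie_algebra_4.intro
      complex_lie_algebra_4_axioms.intro K.complex_lie_algebra_axioms)
    show "dim (UNIV :: 'a set) = 4" by (rule assms(1))
    show "linear \<theta>"
      unfolding \<theta>_def
      by (rule linearI)
        (simp_all add: linear_add[OF K.linear_koszul_form] linear_cmul[OF K.linear_koszul_form] algebra_simps)
    show "x = 0" if "\<And>y. \<theta> (br x y) = 0" for x
      by (rule K.nondegenerate_\<omega>) (use that in \<open>simp add: c \<theta>_def\<close>)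
    show "\<theta> (br (J x) (J y)) = \<theta> (br x y)" for x y
      using K.J_invariant_\<omega>[of x y] by (simp add: c \<theta>_def)
    show "\<theta> x = - 2 * c * Im (p + s)"
      if "K.cbasis a b" "K.D x a = K.cscale p a + K.cscale q b" "K.D x b = K.cscale r a + K.cscale s b"
      for a b x p q r s
      by (simp only: \<theta>_def K.koszul_form_complex_trace[OF that] mult_ac)
  qed
  have g: "g = metric"
    by (simp add: fun_eq_iff assms(3) kaehler_metric_def c metric_def \<theta>_def)
  show ?thesis
  proof (cases "\<forall>x y. K.star x y = 0")
    case True
    then obtain a b where "diagonal_form a b \<or> crossed_form a b"
      using abelian_normal_form by blast
    then show ?thesis
    proof
      assume "diagonal_form a b"
      from diagonal_equivalent[OF this] show ?thesis
        unfolding g by (intro exI[of _ "- 2 * c"] conjI \<kappa>_nonzero disjI1)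
    next
      assume "crossed_form a b"
      from crossed_equivalent[OF this] show ?thesis
        unfolding g
        by (intro exI[of _ "2 * (- 2 * c)"] conjI)
            (simp add: \<kappa>_nonzero[simplified], rule disjI2, rule disjI1)
    qed
  next
    case False
    then obtain \<rho> \<tau> a b where "heisenberg_form \<rho> \<tau> a b"
      using nonabelian_normal_form by blast
    from heisenberg_model[OF this] show ?thesis
      unfolding g by blast
  qed
qed

end
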